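(* Let $X,Y$ be Banach spaces and let $E:D(E)\subset X\to Y$, $A_0:D(A_0)\subset X\to Y$, $B_0:D(B_0)\subset X\to Y$ be linear operators such that $A_0$ is closed; $B_0$ is bounded; $D(E)\subset D(A_0)$ and $E$ is bijective; and $E^{-1}:Y\to D(E)\subset X$ is compact. Put $A:=A_0E^{-1}\in\mathscr{B}(Y)$ and $B:=B_0E^{-1}\in\mathscr{B}(Y)$, and assume $[A,B]:=AB-BA\neq0$. Let $1<\alpha\le2$, $0<\beta\le1$, $\eta,\hat\eta\in Y$, and let $g:\mathbb{J}\to Y$ be continuous. A mild solution $y(\cdot)\in\mathbb{C}^2(\mathbb{J},X)$ of the Cauchy problem $$\left({}^{C}D^{\alpha}_{0+}Ey\right)(t)-A_0\left({}^{C}D^{\beta}_{0+}y\right)(t)=B_0y(t)+g(t),\quad t>0,\qquad Ey(0)=\eta,\quad Ey'(0)=\hat\eta,$$ can be represented, for $t>0$, as $$\begin{aligned}y(t)&=\Big(E^{-1}+\sum_{k=0}^{\infty}\sum_{m=0}^{\infty}E^{-1}Q_{k,m}^{A,B}B\frac{t^{k(\alpha-\beta)+m\alpha+\alpha}}{\Gamma(k(\alpha-\beta)+m\alpha+\alpha+1)}\Big)\eta+\sum_{k=0}^{\infty}\sum_{m=0}^{\infty}E^{-1}Q_{k,m}^{A,B}\frac{t^{k(\alpha-\beta)+m\alpha+1}}{\Gamma(k(\alpha-\beta)+m\alpha+2)}\hat\eta\\&\quad+\int_0^t\sum_{k=0}^{\infty}\sum_{m=0}^{\infty}E^{-1}Q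_{k,m}^{A,B}\frac{(t-s)^{k(\alpha-\beta)+m\alpha+\alpha-1}}{\Gamma(k(\alpha-\beta)+m\alpha+\alpha)}g(s)\,ds\\&=\big(E^{-1}+t^{\alpha}E^{-1}\mathscr{E}^{A,B}_{\alpha-\beta,\alpha,\alpha+1}(t)B\big)\eta+tE^{-1}\mathscr{E}^{A,B}_{\alpha-\beta,\alpha,2}(t)\hat\eta+\int_0^t(t-s)^{\alpha-1}E^{-1}\mathscr{E}^{A,B}_{\alpha-\beta,\alpha,\alpha}(t-s)g(s)\,ds.\end{aligned}$$
   Context: $\mathscr{B}(Y)$ denotes the bounded linear operators on $Y$, $\mathbb{J}=[0,T]$, and $\mathbb{C}^2(\mathbb{J},X)$ the twice continuously differentiable functions $\mathbb{J}\to X$. $B_0E^{-1}$ is understood as an everywhere defined operator on $Y$ (so implicitly $D(E)\subset D(B_0)$). For $n-1<\nu\le n$, $n\in\mathbb{N}$, the Caputo derivative is $({}^{C}D^{\nu}_{0+}x)(t)=\frac{1}{\Gamma(n-\nu)}\int_0^t(t-s)^{n-\nu-1}x^{(n)}(s)\,ds$ (Bochner integral), understood as $x^{(n)}(t)$ when $\nu=n$. A mild solution of the Cauchy problem for $y$ is a function $y=E^{-1}x$, where $x\in\mathbb{C}^2(\mathbb{J},Y)$ solves the transformed problem $({}^{C}D^{\alpha}_{0+}x)(t)-A({}^{C}D^{\beta}_{0+}x)(t)=Bx(t)+g(t)$ for $t>0$, $x(0)=\eta$, $x'(0)=\hat\eta$. The operators $Q_{k,m}^{A,B}\in\mathscr{B}(Y)$,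 $k,m\in\mathbb{N}_0$, are defined by $Q_{k,0}^{A,B}=A^k$ ($k\in\mathbb{N}_0$), $Q_{0,m}^{A,B}=B^m$ ($m\in\mathbb{N}_0$), and $Q_{k,m}^{A,B}=\sum_{l=0}^{k}A^{k-l}BQ_{l,m-1}^{A,B}$ ($k,m\in\mathbb{N}$). For $a,b>0$, $c\in\mathbb{R}$, $$\mathscr{E}^{A,B}_{a,b,c}(t)=\sum_{k=0}^{\infty}\sum_{m=0}^{\infty}Q_{k,m}^{A,B}\frac{t^{ka+mb}}{\Gamma(ka+mb+c)}\in\mathscr{B}(Y).$$ *)

theory Defs
  imports "HOL-Analysis.Analysis"
begin

text \<open>A partially defined operator is a total function together with its domain \<open>D\<close>; nothing is
  assumed about the values outside \<open>D\<close>.\<close>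

definition linear_op_on :: "'a::real_vector set \<Rightarrow> ('a \<Rightarrow> 'b::real_vector) \<Rightarrow> bool" where
  "linear_op_on D f \<longleftrightarrow> subspace D \<and>
     (\<forall>x\<in>D. \<forall>y\<in>D. f (x + y) = f x + f y) \<and> (\<forall>c. \<forall>x\<in>D. f (c *\<^sub>R x) = c *\<^sub>R f x)"

definition closed_op_on :: "'a::real_normed_vector set \<Rightarrow> ('a \<Rightarrow> 'b::real_normed_vector) \<Rightarrow> bool" where
  "closed_op_on D f \<longleftrightarrow> closed ((\<lambda>x. (x, f x)) ` D)"

definition bounded_op_on :: "'a::real_normed_vector set \<Rightarrow> ('a \<Rightarrow> 'b::real_normed_vector) \<Rightarrow> bool" where
  "bounded_op_on D f \<longleftrightarrow> (\<exists>K. \<forall>x\<in>D. norm (f x) \<le> K * norm x)"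

definition compact_op :: "('a::real_normed_vector \<Rightarrow> 'b::real_normed_vector) \<Rightarrow> bool" where
  "compact_op f \<longleftrightarrow> linear f \<and> (\<forall>S. bounded S \<longrightarrow> compact (closure (f ` S)))"

text \<open>The library's \<^const>\<open>has_bochner_integral\<close> is restricted to second countable spaces. For a
  general Banach space, Borel measurability of \<open>f\<close> has to be replaced by strong measurability, i.e.
  \<open>f\<close> is an almost everywhere limit of simple functions. Passing to a subsequence, the same simple
  functions can be used for this and for the approximation in mean.\<close>

definition has_bochner_int :: "'m measure \<Rightarrow> ('m \<Rightarrow> 'b::banach) \<Rightarrow> 'b \<Rightarrow> bool" where
  "has_bochner_int M f I \<longleftrightarrow>
     (\<exists>s. (\<forall>i. Bochner_Integration.simple_bochner_integrable M (s i)) \<and>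
          (AE w in M. (\<lambda>i. s i w) \<longlonglongrightarrow> f w) \<and>
          (\<lambda>i. \<integral>\<^sup>+w. ennreal (norm (f w - s i w)) \<partial>M) \<longlonglongrightarrow> 0 \<and>
          (\<lambda>i. Bochner_Integration.simple_bochner_integral M (s i)) \<longlonglongrightarrow> I)"

definition bochner_integrable :: "'m measure \<Rightarrow> ('m \<Rightarrow> 'b::banach) \<Rightarrow> bool" where
  "bochner_integrable M f \<longleftrightarrow> (\<exists>I. has_bochner_int M f I)"

definition bochner_int :: "'m measure \<Rightarrow> ('m \<Rightarrow> 'b::banach) \<Rightarrow> 'b" where
  "bochner_int M f = (if bochner_integrable M f then THE I. has_bochner_int M f I else 0)"

definition C2_on :: "real set \<Rightarrow> (real \<Rightarrow> 'b::real_normed_vector) \<Rightarrow> bool" where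
  "C2_on J x \<longleftrightarrow> (\<exists>x' x''.
     (\<forall>t\<in>J. (x has_vector_derivative x' t) (at t within J)) \<and>
     (\<forall>t\<in>J. (x' has_vector_derivative x'' t) (at t within J)) \<and>
     continuous_on J x'')"

text \<open>Derivatives at the end points of the interval \<open>J\<close> are one-sided.\<close>

primrec nth_deriv_on :: "real set \<Rightarrow> nat \<Rightarrow> (real \<Rightarrow> 'b::real_normed_vector) \<Rightarrow> real \<Rightarrow> 'b" where
  "nth_deriv_on J 0 x = x"
| "nth_deriv_on J (Suc n) x = (\<lambda>t. vector_derivative (nth_deriv_on J n x) (at t within J))"

text \<open>For \<open>\<nu> > 0\<close>, \<open>nat \<lceil>\<nu>\<rceil>\<close> is the \<open>n\<close> with \<open>n - 1 < \<nu> \<le> n\<close>.\<close>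

definition caputo :: "real set \<Rightarrow> real \<Rightarrow> (real \<Rightarrow> 'b::banach) \<Rightarrow> real \<Rightarrow> 'b" where
  "caputo J \<nu> x t = (let n = nat \<lceil>\<nu>\<rceil> in
     if \<nu> = real n then nth_deriv_on J n x t
     else (1 / Gamma (real n - \<nu>)) *\<^sub>R
            bochner_int (lebesgue_on {0..t})
              (\<lambda>s. ((t - s) powr (real n - \<nu> - 1)) *\<^sub>R nth_deriv_on J n x s))"

definition mild_solution ::
  "real \<Rightarrow> real \<Rightarrow> real \<Rightarrow> ('b::banach \<Rightarrow>\<^sub>L 'a) \<Rightarrow> ('b \<Rightarrow>\<^sub>L 'b) \<Rightarrow> ('b \<Rightarrow>\<^sub>L 'b) \<Rightarrow>
   (real \<Rightarrow> 'b) \<Rightarrow> 'b \<Rightarrow> 'b \<Rightarrow> (real \<Rightarrow> 'a::banach) \<Rightarrow> bool" where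
  "mild_solution T \<alpha> \<beta> Einv A B g \<eta> \<eta>' y \<longleftrightarrow>
     (\<exists>x. C2_on {0..T} x \<and>
          (\<forall>t\<in>{0<..T}. caputo {0..T} \<alpha> x t - A (caputo {0..T} \<beta> x t) = B (x t) + g t) \<and>
          x 0 = \<eta> \<and> vector_derivative x (at 0 within {0..T}) = \<eta>' \<and>
          (\<forall>t\<in>{0..T}. y t = Einv (x t)))"

definition blinfun_pow :: "('b::real_normed_vector \<Rightarrow>\<^sub>L 'b) \<Rightarrow> nat \<Rightarrow> ('b \<Rightarrow>\<^sub>L 'b)" where
  "blinfun_pow A k = (((o\<^sub>L) A) ^^ k) id_blinfun"

fun Qop :: "('b::real_normed_vector \<Rightarrow>\<^sub>L 'b) \<Rightarrow> ('b \<Rightarrow>\<^sub>L 'b) \<Rightarrow> nat \<Rightarrow> nat \<Rightarrow> ('b \<Rightarrow>\<^sub>L 'b)" where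
  "Qop A B k 0 = blinfun_pow A k"
| "Qop A B 0 (Suc m) = blinfun_pow B (Suc m)"
| "Qop A B (Suc k) (Suc m) =
     (\<Sum>l\<le>Suc k. blinfun_pow A (Suc k - l) o\<^sub>L B o\<^sub>L Qop A B l m)"

text \<open>Double series are iterated series, converging in operator norm when the terms are bounded
  operators.\<close>

definition double_summable :: "(nat \<Rightarrow> nat \<Rightarrow> 'c::real_normed_vector) \<Rightarrow> bool" where
  "double_summable f \<longleftrightarrow> (\<forall>k. summable (f k)) \<and> summable (\<lambda>k. \<Sum>m. f k m)"

text \<open>The case distinction is needed because \<open>0 powr 0 = 0\<close>, whereas \<open>t\<^sup>0 = 1\<close> in the term
  with \<open>k = m = 0\<close>, also at \<open>t = 0\<close>. If \<open>k a + m b + c\<close> is a pole of \<^const>\<open>Gamma\<close>, the quotient is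
  \<open>0\<close>, in agreement with the entire function \<open>1 / \<Gamma>\<close>.\<close>

definition mittag_leffler_term ::
  "('b::real_normed_vector \<Rightarrow>\<^sub>L 'b) \<Rightarrow> ('b \<Rightarrow>\<^sub>L 'b) \<Rightarrow> real \<Rightarrow> real \<Rightarrow> real \<Rightarrow> real \<Rightarrow> nat \<Rightarrow> nat \<Rightarrow> ('b \<Rightarrow>\<^sub>L 'b)" where
  "mittag_leffler_term A B a b c t k m =
     ((if k = 0 \<and> m = 0 then 1 else t powr (real k * a + real m * b)) /
        Gamma (real k * a + real m * b + c)) *\<^sub>R Qop A B k m"

definition mittag_leffler ::
  "('b::real_normed_vector \<Rightarrow>\<^sub>L 'b) \<Rightarrow> ('b \<Rightarrow>\<^sub>L 'b) \<Rightarrow> real \<Rightarrow> real \<Rightarrow> real \<Rightarrow> real \<Rightarrow> ('b \<Rightarrow>\<^sub>L 'b)" where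
  "mittag_leffler A B a b c t = (\<Sum>k. \<Sum>m. mittag_leffler_term A B a b c t k m)"

end

theory Submission
  imports Defs
begin

text \<open>
Let \<open>I\<^sup>c\<close> denote the Riemann-Liouville fractional integral of order \<open>c\<close>, and let \<open>u = x - \<eta>\<close> for a solution
\<open>x\<close> of the transformed problem. The semigroup law \<open>I\<^sup>a I\<^sup>b = I\<^bsup>a+b\<^esup>\<close> shows that applying \<open>I\<^sup>\<alpha>\<close> to the
differential equation gives the Volterra equation
\<open>u = A (I\<^bsup>\<alpha>-\<beta>\<^esup> u) + B (I\<^sup>\<alpha> u) + f\<close> with \<open>f t = t \<eta>' + I\<^sup>\<alpha> (B \<eta> + g) t\<close> (\<open>cauchy_problem_volterra\<close>).

This equation is solved by iteration. Fractional integrals commute with \<open>A\<close> and \<open>B\<close>, but \<open>A\<close> and \<open>B\<close> do not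
commute with each other, so the \<open>n\<close>-th power of \<open>A I\<^bsup>\<alpha>-\<beta>\<^esup> + B I\<^sup>\<alpha>\<close> is the sum, over \<open>k + m = n\<close>, of \<open>I\<close> of order
\<open>k (\<alpha> - \<beta>) + m \<alpha>\<close> followed by all products of \<open>k\<close> factors \<open>A\<close> and \<open>m\<close> factors \<open>B\<close>. The sum of these
products is \<open>Qop A B k m\<close> (\<open>Qop_eq\<close>, \<open>iterated_frac_int_Suc\<close>). The remainder after \<open>n\<close> steps tends to \<open>0\<close>
since the Gamma function outgrows every geometric sequence (\<open>Gamma_ge_powr\<close>, \<open>ml_weight_bound\<close>), and \<open>u\<close> is
the sum of the iterates of \<open>f\<close> (\<open>volterra_series\<close>). The fractional integrals of \<open>f\<close> are explicit. The powers
of \<open>t\<close> in \<open>f\<close> yield the two Mittag-Leffler functions outside the integral, and \<open>I\<^sup>\<alpha> g\<close> yields the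
convolution, where summation and integration are exchanged by uniform convergence
(\<open>mittag_leffler_convolution\<close>, \<open>volterra_solution_formula\<close>). The iteration sums along the diagonals \<open>k + m = n\<close>; by
absolute convergence this is the iterated series of the statement (\<open>double_series_diagonal\<close>).

The analytic facts on fractional integrals of vector valued functions, namely continuity, the
semigroup law and \<open>I\<^sup>1 x' = x - x 0\<close>, are stable under uniform limits. Hence they only have to be checked
for monomials with a vector coefficient, where they amount to Euler's Beta integral, and they extend to
continuous functions by Bernstein approximation (\<open>vector_poly_approximation\<close>). Finally, \<open>A\<close> is
bounded by the closed graph theorem.
\<close>

section \<open>Uniform approximation by polynomials with vector coefficients\<close>

lemma continuous_on_Icc_bounded:
  fixes h :: "real \<Rightarrow> 'b::real_normed_vector"
  assumes "continuous_on {a..b} h"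
  obtains M where "0 \<le> M" "\<forall>s\<in>{a..b}. norm (h s) \<le> M"
proof -
  have "bounded (h ` {a..b})"
    by (rule compact_imp_bounded[OF compact_continuous_image[OF assms compact_Icc]])
  then obtain M where "0 < M" "\<forall>x\<in>h ` {a..b}. norm x \<le> M"
    using bounded_pos by blast
  then show ?thesis by (intro that[of M]) auto
qed

text \<open>Defined as an inductive closure, since then every additive property reduces to monomials; this is
how the semigroup law of fractional integrals is obtained below.\<close>

inductive vector_poly :: "(real \<Rightarrow> 'b::real_normed_vector) \<Rightarrow> bool" where
  monomial: "vector_poly (\<lambda>s. s ^ j *\<^sub>R v)"
| add: "vector_poly p \<Longrightarrow> vector_poly q \<Longrightarrow> vector_poly (\<lambda>s. p s + q s)"

lemma vector_poly_const: "vector_poly (\<lambda>s. v)"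
  using vector_poly.monomial[of 0 v] by simp

lemma vector_poly_sum: "(\<And>k. k \<in> S \<Longrightarrow> vector_poly (p k)) \<Longrightarrow> vector_poly (\<lambda>s. \<Sum>k\<in>S. p k s)"
  by (induction S rule: infinite_finite_induct) (auto intro: vector_poly_const vector_poly.add)

lemma vector_poly_scaleR: "vector_poly p \<Longrightarrow> vector_poly (\<lambda>s. c *\<^sub>R p s)"
proof (induction rule: vector_poly.induct)
  case (monomial j v)
  show ?case using vector_poly.monomial[of j "c *\<^sub>R v"] by (simp add: mult.commute)
next
  case (add p q)
  then show ?case using vector_poly.add by (simp add: scaleR_add_right)
qed

lemma vector_poly_times: "vector_poly p \<Longrightarrow> vector_poly (\<lambda>s. s *\<^sub>R p s)"
proof (induction rule: vector_poly.induct)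
  case (monomial j v)
  show ?case using vector_poly.monomial[of "Suc j" v] by simp
next
  case (add p q)
  then show ?case using vector_poly.add by (simp add: scaleR_add_right)
qed

lemma vector_poly_affine_power_times:
  assumes "vector_poly p"
  shows "vector_poly (\<lambda>s. (a + b * s) ^ n *\<^sub>R p s)"
proof (induction n)
  case 0
  show ?case using assms by simp
next
  case (Suc n)
  have "(a + b * s) ^ Suc n *\<^sub>R p s = a *\<^sub>R ((a + b * s) ^ n *\<^sub>R p s) + b *\<^sub>R (s *\<^sub>R ((a + b * s) ^ n *\<^sub>R p s))" for s
    by (simp add: algebra_simps)
  then show ?case
    using vector_poly.add[OF vector_poly_scaleR[OF Suc] vector_poly_scaleR[OF vector_poly_times[OF Suc]]]
    by simp
qed

lemma vector_poly_Bernstein: "vector_poly (\<lambda>s. Bernstein n k (s / T) *\<^sub>R v)"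
proof -
  have "Bernstein n k (s / T) *\<^sub>R v
      = real (n choose k) *\<^sub>R ((0 + (1 / T) * s) ^ k *\<^sub>R ((1 + (- 1 / T) * s) ^ (n - k) *\<^sub>R v))" for s
    by (simp add: Bernstein_def)
  then show ?thesis
    by (simp only:) (intro vector_poly_scaleR vector_poly_affine_power_times vector_poly_const)
qed

lemma continuous_on_vector_poly: "vector_poly p \<Longrightarrow> continuous_on S p"
  by (induction rule: vector_poly.induct) (auto intro!: continuous_intros)

text \<open>Bernstein's proof of the Weierstrass theorem works verbatim for vector values. Uniform continuity
and boundedness give \<open>\<parallel>f x - f y\<parallel> \<le> e/2 + K (x - y)\<^sup>2\<close>, and the mean of \<open>(x - k/n)\<^sup>2\<close> under the
binomial weights is the variance \<open>x (1 - x) / n\<close>, which is uniformly small.\<close>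

lemma vector_poly_approximation:
  fixes h :: "real \<Rightarrow> 'b::real_normed_vector"
  assumes T: "0 < T" and h: "continuous_on {0..T} h" and e: "0 < e"
  obtains p where "vector_poly p" "\<forall>s\<in>{0..T}. norm (h s - p s) < e"
proof -
  define f where "f x = h (T * x)" for x
  have f: "continuous_on {0..1} f"
    unfolding f_def using T
    by (intro continuous_on_compose2[OF h] continuous_intros) (auto simp: mult_left_le)
  obtain M where M0: "0 \<le> M" and M: "\<forall>x\<in>{0..1}. norm (f x) \<le> M"
    using continuous_on_Icc_bounded[OF f] .
  have "uniformly_continuous_on {0..1} f"
    by (rule compact_uniformly_continuous[OF f compact_Icc])
  then obtain d where d: "0 < d"
    "\<forall>x\<in>{0..1}. \<forall>x'\<in>{0..1}. dist x' x < d \<longrightarrow> dist (f x') (f x) < e / 2"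
    using e unfolding uniformly_continuous_on_def by (meson half_gt_zero)
  define K where "K = 2 * M / d\<^sup>2"
  have K: "0 \<le> K" using M0 by (simp add: K_def)
  have quadratic: "norm (f x - f y) \<le> e / 2 + K * (x - y)\<^sup>2" if "x \<in> {0..1}" "y \<in> {0..1}" for x y
  proof (cases "\<bar>x - y\<bar> < d")
    case True
    then have "norm (f x - f y) < e / 2" using d(2) that by (simp add: dist_norm)
    moreover have "0 \<le> K * (x - y)\<^sup>2" using K by simp
    ultimately show ?thesis by linarith
  next
    case False
    then have "d\<^sup>2 \<le> (x - y)\<^sup>2" using d(1) by (simp add: abs_le_square_iff[symmetric])
    then have "K * d\<^sup>2 \<le> K * (x - y)\<^sup>2" using K by (rule mult_left_mono)
    moreover have "K * d\<^sup>2 = 2 * M" using d(1) by (simp add: K_def)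
    moreover have "norm (f x) \<le> M" "norm (f y) \<le> M" using M that by auto
    moreover have "norm (f x - f y) \<le> norm (f x) + norm (f y)" by (rule norm_triangle_ineq4)
    ultimately show ?thesis using e by linarith
  qed
  obtain n :: nat where n: "K / (e / 2) < real n" "0 < n"
    by (metis reals_Archimedean2 K e divide_nonneg_pos half_gt_zero le_less_trans of_nat_0_less_iff)
  have close: "norm (f x - (\<Sum>k\<le>n. Bernstein n k x *\<^sub>R f (k / n))) < e" if x: "x \<in> {0..1}" for x
  proof -
    have B: "0 \<le> Bernstein n k x" for k using x by (intro Bernstein_nonneg) auto
    have expand: "(x - k / n)\<^sup>2 * Bernstein n k x = x\<^sup>2 * Bernstein n k x
        - (2 * x / n) * (real k * Bernstein n k x)
        + (1 / (real n)\<^sup>2) * (real k * (real k - 1) * Bernstein n k x + real k * Bernstein n k x)" for k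
      using n(2) by (simp add: field_simps power2_eq_square)
    have "(\<Sum>k\<le>n. (x - k / n)\<^sup>2 * Bernstein n k x)
        = x\<^sup>2 - (2 * x / n) * (n * x) + (1 / (real n)\<^sup>2) * (real n * (real n - 1) * x\<^sup>2 + n * x)"
      unfolding expand sum.distrib sum_subtractf sum_distrib_left[symmetric] by simp
    also have "\<dots> = x * (1 - x) / n"
      using n(2) by (simp add: field_simps power2_eq_square)
    also have "\<dots> \<le> 1 / n"
      using x by (intro divide_right_mono mult_le_one) auto
    finally have var: "(\<Sum>k\<le>n. (x - k / n)\<^sup>2 * Bernstein n k x) \<le> 1 / n" .
    have "f x - (\<Sum>k\<le>n. Bernstein n k x *\<^sub>R f (k / n)) = (\<Sum>k\<le>n. Bernstein n k x *\<^sub>R (f x - f (k / n)))"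
      by (simp add: scaleR_diff_right sum_subtractf flip: scaleR_left.sum)
    also have "norm \<dots> \<le> (\<Sum>k\<le>n. Bernstein n k x * (e / 2 + K * (x - k / n)\<^sup>2))"
    proof (intro sum_norm_le)
      fix k assume "k \<in> {..n}"
      then have "real k / real n \<in> {0..1}" using n(2) by simp
      from quadratic[OF x this]
      show "norm (Bernstein n k x *\<^sub>R (f x - f (k / n))) \<le> Bernstein n k x * (e / 2 + K * (x - k / n)\<^sup>2)"
        using B by (simp add: mult_left_mono)
    qed
    also have "\<dots> = e / 2 * (\<Sum>k\<le>n. Bernstein n k x) + K * (\<Sum>k\<le>n. (x - k / n)\<^sup>2 * Bernstein n k x)"
      unfolding sum_distrib_left sum.distrib[symmetric] by (intro sum.cong refl) (simp add: algebra_simps)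
    also have "\<dots> \<le> e / 2 + K * (1 / n)"
      using mult_left_mono[OF var K] by simp
    also have "\<dots> < e"
      using n e by (simp add: field_simps)
    finally show ?thesis .
  qed
  show ?thesis
  proof (rule that)
    show "vector_poly (\<lambda>s. \<Sum>k\<le>n. Bernstein n k (s / T) *\<^sub>R f (k / n))"
      by (intro vector_poly_sum vector_poly_Bernstein)
    show "\<forall>s\<in>{0..T}. norm (h s - (\<Sum>k\<le>n. Bernstein n k (s / T) *\<^sub>R f (k / n))) < e"
    proof
      fix s assume "s \<in> {0..T}"
      then have "s / T \<in> {0..1}" "f (s / T) = h s" using T by (simp_all add: f_def)
      then show "norm (h s - (\<Sum>k\<le>n. Bernstein n k (s / T) *\<^sub>R f (k / n))) < e"
        using close by metis
    qed
  qed
qed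

section \<open>Bochner integrals in arbitrary Banach spaces\<close>

lemma norm_simple_bochner_integral_diff_le:
  fixes u v :: "'m \<Rightarrow> 'b::real_normed_vector"
  assumes u: "Bochner_Integration.simple_bochner_integrable M u" and v: "Bochner_Integration.simple_bochner_integrable M v"
  shows "ennreal (norm (Bochner_Integration.simple_bochner_integral M u - Bochner_Integration.simple_bochner_integral M v))
     \<le> (\<integral>\<^sup>+w. ennreal (norm (u w - v w)) \<partial>M)"
proof -
  have d: "Bochner_Integration.simple_bochner_integrable M (\<lambda>w. u w - v w)"
    using Bochner_Integration.simple_bochner_integrable_compose2[OF _ u v, of "(-)"] by simp
  have n: "Bochner_Integration.simple_bochner_integrable M (\<lambda>w. norm (u w - v w))"
    using Bochner_Integration.simple_bochner_integrable_compose2[OF _ u v, of "\<lambda>a b. norm (a - b)"] by simp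
  have "norm (Bochner_Integration.simple_bochner_integral M u - Bochner_Integration.simple_bochner_integral M v)
      \<le> Bochner_Integration.simple_bochner_integral M (\<lambda>w. norm (u w - v w))"
    unfolding Bochner_Integration.simple_bochner_integral_diff[OF u v, symmetric]
    by (rule Bochner_Integration.simple_bochner_integral_norm_bound[OF d])
  then have "ennreal (norm (Bochner_Integration.simple_bochner_integral M u - Bochner_Integration.simple_bochner_integral M v))
      \<le> ennreal (Bochner_Integration.simple_bochner_integral M (\<lambda>w. norm (u w - v w)))"
    by (rule ennreal_leI)
  also have "\<dots> = (\<integral>\<^sup>+w. ennreal (norm (u w - v w)) \<partial>M)"
    by (rule Bochner_Integration.simple_bochner_integral_eq_nn_integral[OF n]) simp
  finally show ?thesis .
qed

text \<open>\<open>f\<close> itself need not be Borel measurable when its range is not separable, but the distance of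
  \<open>f\<close> to a simple function is almost everywhere a limit of real measurable functions.\<close>

lemma norm_diff_AE_measurable:
  fixes f :: "'m \<Rightarrow> 'b::real_normed_vector"
  assumes s: "\<And>i. simple_function M (s i)" and u: "simple_function M u"
    and lim: "AE w in M. (\<lambda>i. s i w) \<longlonglongrightarrow> f w"
  obtains h where "h \<in> borel_measurable M" "AE w in M. ennreal (norm (f w - u w)) = h w"
proof
  have "simple_function M (\<lambda>w. ennreal (norm (s i w - u w)))" for i
    by (rule simple_function_compose2[OF s u])
  then show "(\<lambda>w. liminf (\<lambda>i. ennreal (norm (s i w - u w)))) \<in> borel_measurable M"
    by (intro borel_measurable_liminf borel_measurable_simple_function)
  show "AE w in M. ennreal (norm (f w - u w)) = liminf (\<lambda>i. ennreal (norm (s i w - u w)))"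
    using lim
  proof eventually_elim
    case (elim w)
    have "(\<lambda>i. ennreal (norm (s i w - u w))) \<longlonglongrightarrow> ennreal (norm (f w - u w))"
      by (intro tendsto_ennrealI tendsto_norm tendsto_diff elim tendsto_const)
    from lim_imp_Liminf[OF sequentially_bot this] show ?case by (rule sym)
  qed
qed

lemma nn_integral_norm_diff_triangle:
  fixes f :: "'m \<Rightarrow> 'b::real_normed_vector"
  assumes s: "\<And>i. simple_function M (s i)" and u: "simple_function M u" and v: "simple_function M v"
    and lim: "AE w in M. (\<lambda>i. s i w) \<longlonglongrightarrow> f w"
  shows "(\<integral>\<^sup>+w. ennreal (norm (u w - v w)) \<partial>M)
     \<le> (\<integral>\<^sup>+w. ennreal (norm (f w - u w)) \<partial>M) + (\<integral>\<^sup>+w. ennreal (norm (f w - v w)) \<partial>M)"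
proof -
  obtain h where h: "h \<in> borel_measurable M" "AE w in M. ennreal (norm (f w - u w)) = h w"
    by (rule norm_diff_AE_measurable[OF s u lim])
  obtain k where k: "k \<in> borel_measurable M" "AE w in M. ennreal (norm (f w - v w)) = k w"
    by (rule norm_diff_AE_measurable[OF s v lim])
  have "AE w in M. ennreal (norm (u w - v w)) \<le> h w + k w"
    using h(2) k(2)
  proof eventually_elim
    case (elim w)
    have "norm (u w - v w) \<le> norm (f w - u w) + norm (f w - v w)"
      using norm_triangle_ineq4[of "f w - v w" "f w - u w"] by simp
    then show ?case
      unfolding elim[symmetric] ennreal_plus[OF norm_ge_zero norm_ge_zero, symmetric] by (rule ennreal_leI)
  qed
  then have "(\<integral>\<^sup>+w. ennreal (norm (u w - v w)) \<partial>M) \<le> (\<integral>\<^sup>+w. h w + k w \<partial>M)"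
    by (rule nn_integral_mono_AE)
  also have "\<dots> = (\<integral>\<^sup>+w. h w \<partial>M) + (\<integral>\<^sup>+w. k w \<partial>M)"
    by (rule nn_integral_add[OF h(1) k(1)])
  also have "\<dots> = (\<integral>\<^sup>+w. ennreal (norm (f w - u w)) \<partial>M) + (\<integral>\<^sup>+w. ennreal (norm (f w - v w)) \<partial>M)"
    using h(2) k(2) by (auto intro!: arg_cong2[where f="(+)"] nn_integral_cong_AE elim: eventually_mono)
  finally show ?thesis .
qed

text \<open>The witness in the definition of the integral, named so that its properties can be passed around.\<close>

definition bochner_approx :: "'m measure \<Rightarrow> ('m \<Rightarrow> 'b::banach) \<Rightarrow> 'b \<Rightarrow> (nat \<Rightarrow> 'm \<Rightarrow> 'b) \<Rightarrow> bool" where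
  "bochner_approx M f I s \<longleftrightarrow>
     (\<forall>i. Bochner_Integration.simple_bochner_integrable M (s i)) \<and>
     (AE w in M. (\<lambda>i. s i w) \<longlonglongrightarrow> f w) \<and>
     (\<lambda>i. \<integral>\<^sup>+w. ennreal (norm (f w - s i w)) \<partial>M) \<longlonglongrightarrow> 0 \<and>
     (\<lambda>i. Bochner_Integration.simple_bochner_integral M (s i)) \<longlonglongrightarrow> I"

lemma has_bochner_int_iff: "has_bochner_int M f I \<longleftrightarrow> (\<exists>s. bochner_approx M f I s)"
  by (simp add: has_bochner_int_def bochner_approx_def)

lemma bochner_approxD:
  assumes "bochner_approx M f I s"
  shows "Bochner_Integration.simple_bochner_integrable M (s i)" "simple_function M (s i)"
    "AE w in M. (\<lambda>i. s i w) \<longlonglongrightarrow> f w"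
    "(\<lambda>i. \<integral>\<^sup>+w. ennreal (norm (f w - s i w)) \<partial>M) \<longlonglongrightarrow> 0"
    "(\<lambda>i. Bochner_Integration.simple_bochner_integral M (s i)) \<longlonglongrightarrow> I"
  using assms by (auto simp: bochner_approx_def elim: Bochner_Integration.simple_bochner_integrable.cases)

lemma has_bochner_int_cong_AE:
  assumes "has_bochner_int M f I" and eq: "AE w in M. f w = g w"
  shows "has_bochner_int M g I"
proof -
  obtain s where "bochner_approx M f I s"
    using assms(1) by (auto simp: has_bochner_int_iff)
  note s = bochner_approxD[OF this]
  have "(\<integral>\<^sup>+w. ennreal (norm (f w - s i w)) \<partial>M) = (\<integral>\<^sup>+w. ennreal (norm (g w - s i w)) \<partial>M)" for i
    using eq by (intro nn_integral_cong_AE) (auto elim: eventually_mono)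
  moreover have "AE w in M. (\<lambda>i. s i w) \<longlonglongrightarrow> g w"
    using s(3) eq by eventually_elim simp
  ultimately show ?thesis
    unfolding has_bochner_int_def using s by (intro exI[of _ s]) auto
qed

lemma has_bochner_int_add:
  assumes "has_bochner_int M f I" and "has_bochner_int M g J"
  shows "has_bochner_int M (\<lambda>w. f w + g w) (I + J)"
proof -
  obtain s where "bochner_approx M f I s"
    using assms(1) by (auto simp: has_bochner_int_iff)
  note s = bochner_approxD[OF this]
  obtain r where "bochner_approx M g J r"
    using assms(2) by (auto simp: has_bochner_int_iff)
  note r = bochner_approxD[OF this]
  have le: "(\<integral>\<^sup>+w. ennreal (norm (f w + g w - (s i w + r i w))) \<partial>M)
     \<le> (\<integral>\<^sup>+w. ennreal (norm (f w - s i w)) \<partial>M) + (\<integral>\<^sup>+w. ennreal (norm (g w - r i w)) \<partial>M)" for i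
  proof -
    obtain h where h: "h \<in> borel_measurable M" "AE w in M. ennreal (norm (f w - s i w)) = h w"
      by (rule norm_diff_AE_measurable[OF s(2) s(2) s(3)])
    obtain k where k: "k \<in> borel_measurable M" "AE w in M. ennreal (norm (g w - r i w)) = k w"
      by (rule norm_diff_AE_measurable[OF r(2) r(2) r(3)])
    have "AE w in M. ennreal (norm (f w + g w - (s i w + r i w))) \<le> h w + k w"
      using h(2) k(2)
    proof eventually_elim
      case (elim w)
      show ?case
        unfolding elim[symmetric] ennreal_plus[OF norm_ge_zero norm_ge_zero, symmetric]
        by (intro ennreal_leI norm_diff_triangle_ineq)
    qed
    then have "(\<integral>\<^sup>+w. ennreal (norm (f w + g w - (s i w + r i w))) \<partial>M) \<le> (\<integral>\<^sup>+w. h w + k w \<partial>M)"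
      by (rule nn_integral_mono_AE)
    also have "\<dots> = (\<integral>\<^sup>+w. h w \<partial>M) + (\<integral>\<^sup>+w. k w \<partial>M)"
      by (rule nn_integral_add[OF h(1) k(1)])
    also have "\<dots> = (\<integral>\<^sup>+w. ennreal (norm (f w - s i w)) \<partial>M) + (\<integral>\<^sup>+w. ennreal (norm (g w - r i w)) \<partial>M)"
      using h(2) k(2) by (auto intro!: arg_cong2[where f="(+)"] nn_integral_cong_AE elim: eventually_mono)
    finally show ?thesis .
  qed
  show ?thesis
    unfolding has_bochner_int_def
  proof (intro exI[of _ "\<lambda>i w. s i w + r i w"] conjI allI)
    show "Bochner_Integration.simple_bochner_integrable M (\<lambda>w. s i w + r i w)" for i
      using Bochner_Integration.simple_bochner_integrable_compose2[OF _ s(1) r(1), of "(+)"] by simp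
    show "AE w in M. (\<lambda>i. s i w + r i w) \<longlonglongrightarrow> f w + g w"
      using s(3) r(3) by eventually_elim (rule tendsto_add)
    show "(\<lambda>i. \<integral>\<^sup>+w. ennreal (norm (f w + g w - (s i w + r i w))) \<partial>M) \<longlonglongrightarrow> 0"
    proof (rule tendsto_sandwich[OF _ _ tendsto_const])
      show "(\<lambda>i. (\<integral>\<^sup>+w. ennreal (norm (f w - s i w)) \<partial>M) + (\<integral>\<^sup>+w. ennreal (norm (g w - r i w)) \<partial>M)) \<longlonglongrightarrow> 0"
        using tendsto_add[OF s(4) r(4)] by simp
    qed (use le in auto)
    show "(\<lambda>i. Bochner_Integration.simple_bochner_integral M (\<lambda>w. s i w + r i w)) \<longlonglongrightarrow> I + J"
      unfolding Bochner_Integration.simple_bochner_integral_add[OF s(1) r(1)] by (intro tendsto_add s r)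
  qed
qed

lemma has_bochner_int_bounded_linear:
  assumes "has_bochner_int M f I" and L: "bounded_linear L"
  shows "has_bochner_int M (\<lambda>w. L (f w)) (L I)"
proof -
  interpret bounded_linear L by fact
  obtain s where "bochner_approx M f I s"
    using assms(1) by (auto simp: has_bochner_int_iff)
  note s = bochner_approxD[OF this]
  obtain K where K: "0 \<le> K" "\<And>x. norm (L x) \<le> norm x * K"
    using nonneg_bounded by blast
  have le: "(\<integral>\<^sup>+w. ennreal (norm (L (f w) - L (s i w))) \<partial>M) \<le> ennreal K * (\<integral>\<^sup>+w. ennreal (norm (f w - s i w)) \<partial>M)" for i
  proof -
    obtain h where h: "h \<in> borel_measurable M" "AE w in M. ennreal (norm (f w - s i w)) = h w"
      by (rule norm_diff_AE_measurable[OF s(2) s(2) s(3)])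
    have "AE w in M. ennreal (norm (L (f w) - L (s i w))) \<le> ennreal K * h w"
      using h(2)
    proof eventually_elim
      case (elim w)
      show ?case
        using K(2)[of "f w - s i w"]
        unfolding elim[symmetric] ennreal_mult[OF K(1) norm_ge_zero, symmetric]
        by (intro ennreal_leI) (simp add: diff mult.commute)
    qed
    then have "(\<integral>\<^sup>+w. ennreal (norm (L (f w) - L (s i w))) \<partial>M) \<le> (\<integral>\<^sup>+w. ennreal K * h w \<partial>M)"
      by (rule nn_integral_mono_AE)
    also have "\<dots> = ennreal K * (\<integral>\<^sup>+w. h w \<partial>M)"
      by (rule nn_integral_cmult[OF h(1)])
    also have "(\<integral>\<^sup>+w. h w \<partial>M) = (\<integral>\<^sup>+w. ennreal (norm (f w - s i w)) \<partial>M)"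
      using h(2) by (auto intro!: nn_integral_cong_AE elim: eventually_mono)
    finally show ?thesis .
  qed
  show ?thesis
    unfolding has_bochner_int_def
  proof (intro exI[of _ "\<lambda>i w. L (s i w)"] conjI allI)
    show "Bochner_Integration.simple_bochner_integrable M (\<lambda>w. L (s i w))" for i
      using Bochner_Integration.simple_bochner_integrable_compose2[OF _ s(1) s(1), of "\<lambda>x y. L x"] by (simp add: zero)
    show "AE w in M. (\<lambda>i. L (s i w)) \<longlonglongrightarrow> L (f w)"
      using s(3) by eventually_elim (rule tendsto)
    show "(\<lambda>i. \<integral>\<^sup>+w. ennreal (norm (L (f w) - L (s i w))) \<partial>M) \<longlonglongrightarrow> 0"
    proof (rule tendsto_sandwich[OF _ _ tendsto_const])
      show "(\<lambda>i. ennreal K * (\<integral>\<^sup>+w. ennreal (norm (f w - s i w)) \<partial>M)) \<longlonglongrightarrow> 0"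
        using ennreal_tendsto_cmult[OF _ s(4), of "ennreal K"] by simp
    qed (use le in auto)
    show "(\<lambda>i. Bochner_Integration.simple_bochner_integral M (\<lambda>w. L (s i w))) \<longlonglongrightarrow> L I"
      unfolding Bochner_Integration.simple_bochner_integral_linear[OF linear_axioms s(1)] by (intro tendsto s)
  qed
qed

text \<open>Together with additivity this bound yields uniqueness of the integral, and later on it is the only
estimate needed for passing to the limit under the integral sign.\<close>

lemma has_bochner_int_norm_le:
  assumes "has_bochner_int M f I" and \<psi>: "integrable M \<psi>" and le: "AE w in M. norm (f w) \<le> \<psi> w"
  shows "norm I \<le> (\<integral>w. \<psi> w \<partial>M)"
proof -
  obtain s where "bochner_approx M f I s"
    using assms(1) by (auto simp: has_bochner_int_iff)
  note s = bochner_approxD[OF this]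
  have z: "Bochner_Integration.simple_bochner_integrable M (\<lambda>w. 0)" "Bochner_Integration.simple_bochner_integral M (\<lambda>w. 0) = 0"
    by (auto intro!: Bochner_Integration.simple_bochner_integrable.intros sum.neutral
        simp: Bochner_Integration.simple_bochner_integral_def)
  have nonneg: "AE w in M. 0 \<le> \<psi> w"
    using le by eventually_elim (auto intro: order_trans[OF norm_ge_zero])
  have f: "(\<integral>\<^sup>+w. ennreal (norm (f w - 0)) \<partial>M) \<le> ennreal (\<integral>w. \<psi> w \<partial>M)"
    unfolding nn_integral_eq_integral[OF \<psi> nonneg, symmetric]
    using le by (intro nn_integral_mono_AE) (auto elim!: eventually_mono intro: ennreal_leI)
  have "ennreal (norm (Bochner_Integration.simple_bochner_integral M (s i)))
      \<le> ennreal (\<integral>w. \<psi> w \<partial>M) + (\<integral>\<^sup>+w. ennreal (norm (f w - s i w)) \<partial>M)" for i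
  proof -
    have "ennreal (norm (Bochner_Integration.simple_bochner_integral M (s i)))
      \<le> (\<integral>\<^sup>+w. ennreal (norm (0 - s i w)) \<partial>M)"
      using norm_simple_bochner_integral_diff_le[OF z(1) s(1)] by (simp add: z(2))
    also have "\<dots> \<le> (\<integral>\<^sup>+w. ennreal (norm (f w - 0)) \<partial>M) + (\<integral>\<^sup>+w. ennreal (norm (f w - s i w)) \<partial>M)"
      by (rule nn_integral_norm_diff_triangle[OF s(2) _ s(2) s(3)]) simp
    also have "\<dots> \<le> ennreal (\<integral>w. \<psi> w \<partial>M) + (\<integral>\<^sup>+w. ennreal (norm (f w - s i w)) \<partial>M)"
      by (intro add_right_mono f)
    finally show ?thesis .
  qed
  then have "ennreal (norm I) \<le> ennreal (\<integral>w. \<psi> w \<partial>M) + 0"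
    by (intro tendsto_le[OF _ tendsto_add[OF tendsto_const s(4)] tendsto_ennrealI[OF tendsto_norm[OF s(5)]]]) auto
  then show ?thesis
    using integral_nonneg_AE[OF nonneg] by simp
qed

lemma has_bochner_int_unique:
  assumes I: "has_bochner_int M f I" and J: "has_bochner_int M f J"
  shows "I = J"
proof -
  have "has_bochner_int M (\<lambda>w. - f w) (- J)"
    by (rule has_bochner_int_bounded_linear[OF J bounded_linear_minus[OF bounded_linear_ident]])
  from has_bochner_int_add[OF I this] have "has_bochner_int M (\<lambda>w. 0) (I - J)" by simp
  from has_bochner_int_norm_le[OF this, of "\<lambda>w. 0"] show ?thesis by simp
qed

lemma bochner_int_eqI:
  assumes "has_bochner_int M f I"
  shows "bochner_integrable M f" "bochner_int M f = I"
proof -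
  show *: "bochner_integrable M f" using assms by (auto simp: bochner_integrable_def)
  have "(THE J. has_bochner_int M f J) = I"
    using assms by (rule the_equality) (rule has_bochner_int_unique[OF _ assms])
  then show "bochner_int M f = I" using * by (simp add: bochner_int_def)
qed

text \<open>The real functions \<open>\<parallel>f - s i\<parallel>\<close> tend to \<open>0\<close> and are dominated by \<open>2 \<psi>\<close>, so their integrals tend
to \<open>0\<close> by dominated convergence. Hence the integrals of the \<open>s i\<close> form a Cauchy sequence, and completeness
provides the value of the integral.\<close>

lemma has_bochner_int_dominated:
  fixes f :: "'m \<Rightarrow> 'b::banach" and \<psi> :: "'m \<Rightarrow> real"
  assumes s: "\<And>i. simple_function M (s i)" and \<psi>: "integrable M \<psi>"
    and lim: "AE w in M. (\<lambda>i. s i w) \<longlonglongrightarrow> f w"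
    and le: "\<And>i w. w \<in> space M \<Longrightarrow> norm (s i w) \<le> \<psi> w"
  obtains I where "has_bochner_int M f I" "(\<lambda>i. Bochner_Integration.simple_bochner_integral M (s i)) \<longlonglongrightarrow> I"
proof -
  \<comment> \<open>\<open>f\<close> inherits the bound \<open>\<psi>\<close>, so \<open>2 \<psi>\<close> dominates the differences \<open>f - s i\<close>\<close>
  have fin: "(\<integral>\<^sup>+w. ennreal (2 * \<psi> w) \<partial>M) < \<infinity>"
  proof -
    have "0 \<le> \<psi> w" if "w \<in> space M" for w
      using order_trans[OF norm_ge_zero le[OF that]] .
    then have "(\<integral>\<^sup>+w. ennreal (2 * \<psi> w) \<partial>M) = ennreal (\<integral>w. 2 * \<psi> w \<partial>M)"
      using \<psi> by (intro nn_integral_eq_integral) auto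
    then show ?thesis by simp
  qed
  have si: "Bochner_Integration.simple_bochner_integrable M (s i)" for i
  proof (rule Bochner_Integration.simple_bochner_integrableI_bounded[OF s])
    have "(\<integral>\<^sup>+w. ennreal (norm (s i w)) \<partial>M) \<le> (\<integral>\<^sup>+w. ennreal (2 * \<psi> w) \<partial>M)"
      using le[of _ i] norm_ge_zero[of "s i _"] by (intro nn_integral_mono ennreal_leI) (smt (verit))
    then show "(\<integral>\<^sup>+w. ennreal (norm (s i w)) \<partial>M) < \<infinity>"
      using fin by (rule le_less_trans)
  qed
  have "\<exists>h. \<forall>i. h i \<in> borel_measurable M \<and> (AE w in M. ennreal (norm (f w - s i w)) = h i w)"
  proof (intro choice allI)
    fix i
    obtain h where "h \<in> borel_measurable M" "AE w in M. ennreal (norm (f w - s i w)) = h w"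
      by (rule norm_diff_AE_measurable[OF s s lim])
    then show "\<exists>h. h \<in> borel_measurable M \<and> (AE w in M. ennreal (norm (f w - s i w)) = h w)" by blast
  qed
  then obtain h where h: "\<And>i. h i \<in> borel_measurable M" "\<And>i. AE w in M. ennreal (norm (f w - s i w)) = h i w"
    by blast
  have all: "AE w in M. \<forall>i. ennreal (norm (f w - s i w)) = h i w"
    using h(2) by (simp add: AE_all_countable)
  have "(\<lambda>i. \<integral>\<^sup>+w. h i w \<partial>M) \<longlonglongrightarrow> (\<integral>\<^sup>+w. 0 \<partial>M)"
  proof (rule nn_integral_dominated_convergence[OF h(1) _ _ _ fin])
    show "AE w in M. h i w \<le> ennreal (2 * \<psi> w)" for i
      using h(2)[of i] lim AE_space
    proof eventually_elim
      case (elim w)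
      have "norm (f w) \<le> \<psi> w"
        by (rule tendsto_upperbound[OF tendsto_norm[OF elim(2)]]) (use le elim in auto)
      then have "norm (f w - s i w) \<le> 2 * \<psi> w"
        using le[OF elim(3), of i] norm_triangle_ineq4[of "f w" "s i w"] by linarith
      then show ?case unfolding elim(1)[symmetric] by (rule ennreal_leI)
    qed
    show "AE w in M. (\<lambda>i. h i w) \<longlonglongrightarrow> 0"
      using all lim
    proof eventually_elim
      case (elim w)
      have "(\<lambda>i. ennreal (norm (f w - s i w))) \<longlonglongrightarrow> ennreal (norm (f w - f w))"
        by (intro tendsto_ennrealI tendsto_norm tendsto_diff elim tendsto_const)
      then show ?case using elim(1) by simp
    qed
  qed (use \<psi> in auto)
  moreover have "(\<integral>\<^sup>+w. h i w \<partial>M) = (\<integral>\<^sup>+w. ennreal (norm (f w - s i w)) \<partial>M)" for i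
    using h(2)[of i] by (auto intro!: nn_integral_cong_AE elim: eventually_mono)
  ultimately have L1: "(\<lambda>i. \<integral>\<^sup>+w. ennreal (norm (f w - s i w)) \<partial>M) \<longlonglongrightarrow> 0" by simp
  have "Cauchy (\<lambda>i. Bochner_Integration.simple_bochner_integral M (s i))"
  proof (rule CauchyI)
    fix e :: real assume e: "0 < e"
    then have "eventually (\<lambda>i. (\<integral>\<^sup>+w. ennreal (norm (f w - s i w)) \<partial>M) < ennreal (e / 3)) sequentially"
      using L1 by (intro order_tendstoD(2)) auto
    then obtain N where N: "\<And>i. i \<ge> N \<Longrightarrow> (\<integral>\<^sup>+w. ennreal (norm (f w - s i w)) \<partial>M) < ennreal (e / 3)"
      by (auto simp: eventually_sequentially)
    show "\<exists>N. \<forall>m\<ge>N. \<forall>n\<ge>N. norm (Bochner_Integration.simple_bochner_integral M (s m) - Bochner_Integration.simple_bochner_integral M (s n)) < e"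
    proof (intro exI[of _ N] allI impI)
      fix m n assume mn: "N \<le> m" "N \<le> n"
      have "ennreal (norm (Bochner_Integration.simple_bochner_integral M (s m) - Bochner_Integration.simple_bochner_integral M (s n)))
         \<le> (\<integral>\<^sup>+w. ennreal (norm (s m w - s n w)) \<partial>M)"
        by (rule norm_simple_bochner_integral_diff_le[OF si si])
      also have "\<dots> \<le> (\<integral>\<^sup>+w. ennreal (norm (f w - s m w)) \<partial>M) + (\<integral>\<^sup>+w. ennreal (norm (f w - s n w)) \<partial>M)"
        by (rule nn_integral_norm_diff_triangle[OF s s s lim])
      also have "\<dots> \<le> ennreal (e / 3) + ennreal (e / 3)"
        using N[OF mn(1)] N[OF mn(2)] by (intro add_mono less_imp_le)
      also have "\<dots> < ennreal e" using e by (simp flip: ennreal_plus add: ennreal_less_iff)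
      finally show "norm (Bochner_Integration.simple_bochner_integral M (s m) - Bochner_Integration.simple_bochner_integral M (s n)) < e"
        by (simp add: ennreal_less_iff)
    qed
  qed
  then obtain I where "(\<lambda>i. Bochner_Integration.simple_bochner_integral M (s i)) \<longlonglongrightarrow> I"
    using Cauchy_convergent convergent_def by blast
  moreover from this have "has_bochner_int M f I"
    unfolding has_bochner_int_def using si lim L1 by blast
  ultimately show ?thesis using that by blast
qed

lemma ex_dominated_simple_sequence:
  fixes \<phi> :: "'m \<Rightarrow> real"
  assumes "integrable M \<phi>"
  shows "\<exists>s. (\<forall>i. simple_function M (s i)) \<and> (\<forall>i. Bochner_Integration.simple_bochner_integrable M (s i)) \<and>
    (\<forall>x\<in>space M. (\<lambda>i. s i x) \<longlonglongrightarrow> \<phi> x) \<and> (\<forall>i. \<forall>x\<in>space M. norm (s i x) \<le> 2 * norm (\<phi> x))"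
proof (rule integrable_implies_simple_function_sequence[OF assms])
  fix s :: "nat \<Rightarrow> 'm \<Rightarrow> real"
  assume s: "\<And>i. simple_function M (s i)" "\<And>i. emeasure M {y \<in> space M. s i y \<noteq> 0} \<noteq> \<infinity>"
    "\<And>x. x \<in> space M \<Longrightarrow> (\<lambda>i. s i x) \<longlonglongrightarrow> \<phi> x"
    "\<And>x i. x \<in> space M \<Longrightarrow> norm (s i x) \<le> 2 * norm (\<phi> x)"
  show ?thesis
    by (intro exI[of _ s] conjI allI ballI s Bochner_Integration.simple_bochner_integrable.intros)
qed

lemma has_bochner_int_real:
  fixes \<phi> :: "'m \<Rightarrow> real"
  assumes "integrable M \<phi>"
  shows "has_bochner_int M \<phi> (\<integral>w. \<phi> w \<partial>M)"
proof -
  obtain s where s: "\<forall>i. simple_function M (s i)" "\<forall>i. Bochner_Integration.simple_bochner_integrable M (s i)"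
    "\<forall>x\<in>space M. (\<lambda>i. s i x) \<longlonglongrightarrow> \<phi> x" "\<forall>i. \<forall>x\<in>space M. norm (s i x) \<le> 2 * norm (\<phi> x)"
    using ex_dominated_simple_sequence[OF assms] by blast
  have \<psi>: "integrable M (\<lambda>w. 2 * norm (\<phi> w))" using assms by simp
  obtain I where I: "has_bochner_int M \<phi> I"
    "(\<lambda>i. Bochner_Integration.simple_bochner_integral M (s i)) \<longlonglongrightarrow> I"
    by (rule has_bochner_int_dominated[OF s(1)[rule_format] \<psi> AE_I2[OF s(3)[rule_format]] s(4)[rule_format]])
  have "(\<lambda>i. \<integral>w. s i w \<partial>M) \<longlonglongrightarrow> (\<integral>w. \<phi> w \<partial>M)"
    using assms s by (intro integral_dominated_convergence[OF borel_measurable_integrable[OF assms] _ \<psi>]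
        AE_I2 borel_measurable_simple_function) auto
  moreover have "Bochner_Integration.simple_bochner_integral M (s i) = (\<integral>w. s i w \<partial>M)" for i
    using s(2) by (intro simple_bochner_integrable_eq_integral) simp
  ultimately show ?thesis using I LIMSEQ_unique by auto
qed

lemma has_bochner_int_scaleR_const:
  fixes v :: "'b::banach"
  assumes "integrable M \<phi>"
  shows "has_bochner_int M (\<lambda>w. \<phi> w *\<^sub>R v) ((\<integral>w. \<phi> w \<partial>M) *\<^sub>R v)"
  by (rule has_bochner_int_bounded_linear[OF has_bochner_int_real[OF assms] bounded_linear_scaleR_left])

lemma bochner_int_cong_AE:
  assumes "AE w in M. f w = g w"
  shows "bochner_int M f = bochner_int M g"
proof -
  have assms': "AE w in M. g w = f w"
    using assms by eventually_elim simp
  have "has_bochner_int M f I = has_bochner_int M g I" for I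
    using has_bochner_int_cong_AE[OF _ assms] has_bochner_int_cong_AE[OF _ assms'] by blast
  then show ?thesis by (simp only: bochner_int_def bochner_integrable_def)
qed

text \<open>The scalar kernel \<open>\<phi>\<close> may be singular, but it is a limit of simple functions dominated by \<open>2 \<bar>\<phi>\<bar>\<close>.
The continuous factor is replaced by its values on a grid. The product of the two approximations
is simple, and it is dominated by a multiple of \<open>\<bar>\<phi>\<bar>\<close>.\<close>

lemma bochner_integrable_scaleR_continuous:
  fixes h :: "real \<Rightarrow> 'b::banach"
  assumes \<phi>: "integrable (lebesgue_on {0..t}) \<phi>" and h: "continuous_on {0..t} h"
  obtains I where "has_bochner_int (lebesgue_on {0..t}) (\<lambda>s. \<phi> s *\<^sub>R h s) I"
proof -
  let ?M = "lebesgue_on {0..t}"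
  obtain r where r: "\<forall>i. simple_function ?M (r i)" "\<forall>x\<in>space ?M. (\<lambda>i. r i x) \<longlonglongrightarrow> \<phi> x"
    "\<forall>i. \<forall>x\<in>space ?M. norm (r i x) \<le> 2 * norm (\<phi> x)"
    using ex_dominated_simple_sequence[OF \<phi>] by blast
  obtain C where C0: "0 \<le> C" and C: "\<forall>s\<in>{0..t}. norm (h s) \<le> C"
    using continuous_on_Icc_bounded[OF h] .
  \<comment> \<open>rounding down to the grid of width \<open>1 / (i + 1)\<close> does not leave the interval \<open>{0..t}\<close>\<close>
  define p where "p i s = \<lfloor>real (Suc i) * s\<rfloor> / real (Suc i)" for i :: nat and s :: real
  have p: "p i s \<in> {0..t}" "p i s \<le> s" "s - 1 / real (Suc i) \<le> p i s" if "s \<in> {0..t}" for i s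
  proof -
    define n where "n = real (Suc i)"
    have n: "0 < n" by (simp add: n_def)
    have p_eq: "p i s = \<lfloor>n * s\<rfloor> / n" by (simp add: p_def n_def)
    have "0 \<le> n * s" using that n by simp
    then have "0 \<le> real_of_int \<lfloor>n * s\<rfloor>" by simp
    moreover have "real_of_int \<lfloor>n * s\<rfloor> \<le> n * s" by simp
    moreover have "n * s - 1 \<le> real_of_int \<lfloor>n * s\<rfloor>"
      using real_of_int_floor_add_one_ge[of "n * s"] by linarith
    ultimately have "0 \<le> p i s" "p i s \<le> n * s / n" "(n * s - 1) / n \<le> p i s"
      unfolding p_eq using n by (auto intro: divide_right_mono simp only: less_imp_le divide_nonneg_pos)
    moreover have "n * s / n = s" "(n * s - 1) / n = s - 1 / n"
      using n by (simp_all add: field_simps)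
    ultimately have "0 \<le> p i s" "p i s \<le> s" "s - 1 / n \<le> p i s" by simp_all
    then show "p i s \<le> s" "s - 1 / real (Suc i) \<le> p i s" "p i s \<in> {0..t}"
      using that by (simp_all only: n_def, simp_all)
  qed
  have simple: "simple_function ?M (p i)" for i
  proof (rule simple_function_borel_measurable)
    show "p i \<in> borel_measurable ?M"
      unfolding p_def by (intro measurable_restrict_space1 measurable_completion) measurable
    have "p i ` space ?M \<subseteq> (\<lambda>k. real_of_int k / real (Suc i)) ` {0..\<lfloor>real (Suc i) * t\<rfloor>}"
      unfolding p_def by (auto intro!: imageI floor_mono mult_left_mono simp del: of_nat_Suc)
    then show "finite (p i ` space ?M)"
      by (rule finite_subset) simp
  qed
  have lim: "(\<lambda>i. r i s *\<^sub>R h (p i s)) \<longlonglongrightarrow> \<phi> s *\<^sub>R h s" if "s \<in> space ?M" for s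
  proof (intro tendsto_scaleR r(2)[rule_format] that)
    have s: "s \<in> {0..t}" using that by simp
    have "(\<lambda>i. s - 1 / real (Suc i)) \<longlonglongrightarrow> s - 0"
      by (intro tendsto_diff tendsto_const LIMSEQ_Suc[OF lim_1_over_n])
    then have lower: "(\<lambda>i. s - 1 / real (Suc i)) \<longlonglongrightarrow> s" by (simp only: diff_zero)
    have "(\<lambda>i. p i s) \<longlonglongrightarrow> s"
      by (rule real_tendsto_sandwich[OF always_eventually always_eventually lower tendsto_const])
        (use p(2,3)[OF s] in blast)+
    then show "(\<lambda>i. h (p i s)) \<longlonglongrightarrow> h s"
      using h s p(1)[OF s] by (auto simp: continuous_on_sequentially o_def)
  qed
  have \<psi>: "integrable ?M (\<lambda>s. 2 * norm (\<phi> s) * C)" using \<phi> by simp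
  have le: "norm (r i s *\<^sub>R h (p i s)) \<le> 2 * norm (\<phi> s) * C" if "s \<in> space ?M" for i s
    unfolding norm_scaleR using r(3) C p(1) that by (intro mult_mono) auto
  have "simple_function ?M (\<lambda>s. r i s *\<^sub>R h (p i s))" for i
    by (rule simple_function_compose2[OF r(1)[rule_format] simple_function_compose1[OF simple]])
  then show ?thesis
    by (rule has_bochner_int_dominated[OF _ \<psi> AE_I2[OF lim] le]) (assumption+, rule that)
qed

section \<open>Riemann-Liouville fractional integrals\<close>

text \<open>The fractional integral of order \<open>c\<close> of the constant \<open>1\<close>. The value for \<open>c = 0\<close> has to be given
separately because \<open>0 powr 0 = 0\<close>.\<close>

definition riesz_kernel :: "real \<Rightarrow> real \<Rightarrow> real" where
  "riesz_kernel c t = (if c = 0 then 1 else t powr c / Gamma (c + 1))"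

text \<open>With the identity as the integral of order \<open>0\<close>, a Caputo derivative is a fractional integral of an
ordinary derivative also when its order is an integer.\<close>

definition frac_int :: "real \<Rightarrow> (real \<Rightarrow> 'b::banach) \<Rightarrow> real \<Rightarrow> 'b" where
  "frac_int a h t = (if a = 0 then h t else
     (1 / Gamma a) *\<^sub>R bochner_int (lebesgue_on {0..t}) (\<lambda>s. (t - s) powr (a - 1) *\<^sub>R h s))"

lemma Gamma_real_neq_0: "0 < x \<Longrightarrow> Gamma x \<noteq> (0 :: real)"
  using Gamma_real_pos[of x] by linarith

lemma riesz_kernel_nonneg: "0 \<le> c \<Longrightarrow> 0 \<le> riesz_kernel c t"
  by (simp add: riesz_kernel_def Gamma_real_pos less_imp_le)

lemma riesz_kernel_mono: "0 \<le> c \<Longrightarrow> 0 \<le> s \<Longrightarrow> s \<le> t \<Longrightarrow> riesz_kernel c s \<le> riesz_kernel c t"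
  by (simp add: riesz_kernel_def Gamma_real_pos less_imp_le divide_right_mono powr_mono2)

lemma continuous_on_riesz_kernel:
  assumes "0 \<le> c"
  shows "continuous_on {0..T} (riesz_kernel c)"
proof (cases "c = 0")
  case False
  have "Gamma (c + 1) \<noteq> 0" using assms by (intro Gamma_real_neq_0) simp
  then have "continuous_on {0..T} (\<lambda>t. t powr c / Gamma (c + 1))"
    using assms False by (intro continuous_intros continuous_on_powr') auto
  then show ?thesis using False by (simp add: riesz_kernel_def cong: continuous_on_cong)
qed (simp add: riesz_kernel_def cong: continuous_on_cong)

text \<open>Euler's Beta integral, rescaled to \<open>[0, t]\<close>.\<close>

lemma has_integral_powr_times_riesz_kernel:
  assumes a: "0 < a" and b: "0 \<le> b" and t: "0 \<le> t"
  shows "((\<lambda>s. (t - s) powr (a - 1) * riesz_kernel b s) has_integral Gamma a * riesz_kernel (b + a) t) {0..t}"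
proof (cases "t = 0")
  case True
  then show ?thesis using a b by (simp add: riesz_kernel_def has_integral_refl)
next
  case False
  with t have t: "0 < t" by simp
  have Gb: "Gamma (b + 1) \<noteq> 0" using b by (intro Gamma_real_neq_0) simp
  have "((\<lambda>r. r powr (b + 1 - 1) * (1 - r) powr (a - 1)) has_integral Beta (b + 1) a) (cbox 0 1)"
    using has_integral_Beta_real[of "b + 1" a] a b by simp
  from has_integral_affinity'[OF this, of "1 / t" 0] t
  have "((\<lambda>s. (s / t) powr b * (1 - s / t) powr (a - 1)) has_integral (t * Beta (b + 1) a)) {0..t}"
    by simp
  from has_integral_mult_right[OF this, of "t powr (b + a - 1) / Gamma (b + 1)"]
  have *: "((\<lambda>s. t powr (b + a - 1) / Gamma (b + 1) * ((s / t) powr b * (1 - s / t) powr (a - 1)))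
      has_integral (t powr (b + a - 1) / Gamma (b + 1) * (t * Beta (b + 1) a))) {0..t}" .
  have val: "t powr (b + a - 1) / Gamma (b + 1) * (t * Beta (b + 1) a) = Gamma a * riesz_kernel (b + a) t"
  proof -
    have "t powr (b + a - 1) * t = t powr (b + a)"
      using t powr_add[of t "b + a - 1" 1] by simp
    then show ?thesis
      using a b Gb by (simp add: riesz_kernel_def Beta_def field_simps)
  qed
  \<comment> \<open>at \<open>s = 0\<close> the two integrands differ if \<open>b = 0\<close>\<close>
  show ?thesis
  proof (rule has_integral_spike_finite[of "{0}"])
    show "(t - s) powr (a - 1) * riesz_kernel b s
        = t powr (b + a - 1) / Gamma (b + 1) * ((s / t) powr b * (1 - s / t) powr (a - 1))"
      if "s \<in> {0..t} - {0}" for s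
    proof -
      have s: "0 < s" "s \<le> t" using that by auto
      have "t - s = t * (1 - s / t)" using t by (simp add: field_simps)
      then have "(t - s) powr (a - 1) = t powr (a - 1) * (1 - s / t) powr (a - 1)"
        using s t by (simp only: powr_mult)
      moreover have "s powr b = t powr b * (s / t) powr b"
        using s t by (subst powr_mult[symmetric]) (auto simp: field_simps)
      moreover have "t powr (b + a - 1) = t powr b * t powr (a - 1)"
        using powr_add[of t b "a - 1"] by (simp add: add_diff_eq)
      moreover have "riesz_kernel b s = s powr b / Gamma (b + 1)"
        using s by (simp add: riesz_kernel_def)
      ultimately show ?thesis by simp
    qed
  qed (use * val in simp_all)
qed

lemma integral_powr_times_riesz_kernel:
  assumes "0 < a" and "0 \<le> b" and "0 \<le> t"
  shows "integrable (lebesgue_on {0..t}) (\<lambda>s. (t - s) powr (a - 1) * riesz_kernel b s)"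
    and "(\<integral>s. (t - s) powr (a - 1) * riesz_kernel b s \<partial>lebesgue_on {0..t}) = Gamma a * riesz_kernel (b + a) t"
proof -
  note * = has_integral_powr_times_riesz_kernel[OF assms]
  have "(\<lambda>s. (t - s) powr (a - 1) * riesz_kernel b s) absolutely_integrable_on {0..t}"
    using * riesz_kernel_nonneg[OF assms(2)] by (intro nonnegative_absolutely_integrable_1) auto
  then show int: "integrable (lebesgue_on {0..t}) (\<lambda>s. (t - s) powr (a - 1) * riesz_kernel b s)"
    by (rule absolutely_integrable_imp_integrable) simp
  show "(\<integral>s. (t - s) powr (a - 1) * riesz_kernel b s \<partial>lebesgue_on {0..t}) = Gamma a * riesz_kernel (b + a) t"
    using lebesgue_integral_eq_integral[OF int] integral_unique[OF *] by simp
qed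

lemma integral_powr:
  assumes "0 < a" and "0 \<le> t"
  shows "integrable (lebesgue_on {0..t}) (\<lambda>s. (t - s) powr (a - 1))"
    and "(\<integral>s. (t - s) powr (a - 1) \<partial>lebesgue_on {0..t}) = Gamma a * riesz_kernel a t"
  using integral_powr_times_riesz_kernel[OF assms(1) order_refl assms(2)] by (simp_all add: riesz_kernel_def)

lemma has_bochner_int_frac_int:
  assumes a: "0 < a" and t: "0 \<le> t" and h: "continuous_on {0..t} h"
  shows "has_bochner_int (lebesgue_on {0..t}) (\<lambda>s. (t - s) powr (a - 1) *\<^sub>R h s) (Gamma a *\<^sub>R frac_int a h t)"
proof -
  obtain I where I: "has_bochner_int (lebesgue_on {0..t}) (\<lambda>s. (t - s) powr (a - 1) *\<^sub>R h s) I"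
    using bochner_integrable_scaleR_continuous[OF integral_powr(1)[OF a t] h] .
  have "Gamma a \<noteq> 0" by (rule Gamma_real_neq_0[OF a])
  then have "Gamma a *\<^sub>R frac_int a h t = I"
    using a bochner_int_eqI(2)[OF I] by (simp add: frac_int_def)
  then show ?thesis using I by simp
qed

lemma frac_int_eqI:
  assumes a: "0 < a" and "has_bochner_int (lebesgue_on {0..t}) (\<lambda>s. (t - s) powr (a - 1) *\<^sub>R h s) (Gamma a *\<^sub>R I)"
  shows "frac_int a h t = I"
  using bochner_int_eqI(2)[OF assms(2)] Gamma_real_neq_0[OF a] a by (simp add: frac_int_def)

lemma frac_int_riesz_kernel:
  assumes a: "0 \<le> a" and b: "0 \<le> b" and t: "0 \<le> t"
  shows "frac_int a (\<lambda>s. riesz_kernel b s *\<^sub>R v) t = riesz_kernel (b + a) t *\<^sub>R v"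
proof (cases "a = 0")
  case False
  with a have a: "0 < a" by simp
  show ?thesis
    using has_bochner_int_scaleR_const[OF integral_powr_times_riesz_kernel(1)[OF a b t], of v]
      integral_powr_times_riesz_kernel(2)[OF a b t]
    by (intro frac_int_eqI[OF a]) simp
qed (simp add: frac_int_def)

lemma frac_int_add:
  assumes a: "0 \<le> a" and t: "0 \<le> t" and h: "continuous_on {0..t} h" "continuous_on {0..t} k"
  shows "frac_int a (\<lambda>s. h s + k s) t = frac_int a h t + frac_int a k t"
proof (cases "a = 0")
  case False
  with a have a: "0 < a" by simp
  show ?thesis
    using has_bochner_int_add[OF has_bochner_int_frac_int[OF a t h(1)] has_bochner_int_frac_int[OF a t h(2)]]
    by (intro frac_int_eqI[OF a]) (simp add: scaleR_add_right)
qed (simp add: frac_int_def)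

lemma frac_int_bounded_linear:
  assumes L: "bounded_linear L" and a: "0 \<le> a" and t: "0 \<le> t" and h: "continuous_on {0..t} h"
  shows "frac_int a (\<lambda>s. L (h s)) t = L (frac_int a h t)"
proof (cases "a = 0")
  case False
  with a have a: "0 < a" by simp
  show ?thesis
    using has_bochner_int_bounded_linear[OF has_bochner_int_frac_int[OF a t h] L]
    by (intro frac_int_eqI[OF a]) (simp add: linear_simps(5)[OF L])
qed (simp add: frac_int_def)

lemma frac_int_sum:
  assumes a: "0 \<le> a" and t: "0 \<le> t" and "finite S" and h: "\<And>i. i \<in> S \<Longrightarrow> continuous_on {0..t} (h i)"
  shows "frac_int a (\<lambda>s. \<Sum>i\<in>S. h i s) t = (\<Sum>i\<in>S. frac_int a (h i) t)"
  using \<open>finite S\<close> h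
proof (induction S)
  case empty
  show ?case using frac_int_riesz_kernel[OF a order_refl t, of 0] by simp
next
  case (insert i S)
  then show ?case by (simp add: frac_int_add[OF a t] continuous_on_sum)
qed

text \<open>The point \<open>0\<close> is left out because the differential equation is only assumed for positive times.\<close>

lemma frac_int_cong:
  assumes a: "0 < a" and eq: "\<And>s. 0 < s \<Longrightarrow> s \<le> t \<Longrightarrow> h s = k s"
  shows "frac_int a h t = frac_int a k t"
proof -
  have "{0} \<inter> {0..t} \<in> null_sets (lebesgue_on {0..t})"
    by (auto simp: null_sets_restrict_space negligible_iff_null_sets[symmetric] intro: negligible_Int)
  then have "AE s in lebesgue_on {0..t}. s \<notin> {0} \<inter> {0..t}"
    by (rule AE_not_in)
  then have "AE s in lebesgue_on {0..t}. (t - s) powr (a - 1) *\<^sub>R h s = (t - s) powr (a - 1) *\<^sub>R k s"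
    using AE_space by eventually_elim (auto simp: eq)
  from bochner_int_cong_AE[OF this] show ?thesis using a by (simp add: frac_int_def)
qed

lemma norm_frac_int_le:
  assumes a: "0 \<le> a" and t: "0 \<le> t" and h: "continuous_on {0..t} h"
    and B: "\<And>s. s \<in> {0..t} \<Longrightarrow> norm (h s) \<le> B"
  shows "norm (frac_int a h t) \<le> riesz_kernel a t * B"
proof (cases "a = 0")
  case True
  then show ?thesis using B[of t] t by (simp add: frac_int_def riesz_kernel_def)
next
  case False
  with a have a: "0 < a" by simp
  have "norm (Gamma a *\<^sub>R frac_int a h t) \<le> (\<integral>s. (t - s) powr (a - 1) * B \<partial>lebesgue_on {0..t})"
  proof (rule has_bochner_int_norm_le[OF has_bochner_int_frac_int[OF a t h]])
    show "AE s in lebesgue_on {0..t}. norm ((t - s) powr (a - 1) *\<^sub>R h s) \<le> (t - s) powr (a - 1) * B"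
      using B by (intro AE_I2) (simp add: mult_left_mono)
  qed (use integral_powr(1)[OF a t] in simp)
  then have "Gamma a * norm (frac_int a h t) \<le> Gamma a * (riesz_kernel a t * B)"
    using integral_powr(2)[OF a t] Gamma_real_pos[OF a] by (simp add: mult.assoc)
  then show ?thesis using Gamma_real_pos[OF a] by simp
qed

lemma frac_int_monomial:
  assumes a: "0 \<le> a" and t: "0 \<le> t"
  shows "frac_int a (\<lambda>s. s ^ j *\<^sub>R v) t = riesz_kernel (real j + a) t *\<^sub>R (fact j *\<^sub>R v)"
proof (cases "a = 0")
  case True
  then show ?thesis using t
    by (cases "j = 0") (auto simp: frac_int_def riesz_kernel_def Gamma_fact add.commute powr_realpow')
next
  case False
  with a have a: "0 < a" by simp
  have "frac_int a (\<lambda>s. s ^ j *\<^sub>R v) t = frac_int a (\<lambda>s. riesz_kernel (real j) s *\<^sub>R (fact j *\<^sub>R v)) t"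
    by (rule frac_int_cong[OF a]) (auto simp: riesz_kernel_def powr_realpow Gamma_fact add.commute)
  also have "\<dots> = riesz_kernel (real j + a) t *\<^sub>R (fact j *\<^sub>R v)"
    using a t by (intro frac_int_riesz_kernel) auto
  finally show ?thesis .
qed

lemma continuous_on_frac_int_vector_poly:
  assumes p: "vector_poly p" and a: "0 \<le> a"
  shows "continuous_on {0..T} (frac_int a p)"
  using p
proof (induction rule: vector_poly.induct)
  case (monomial j v)
  have "continuous_on {0..T} (\<lambda>t. riesz_kernel (real j + a) t *\<^sub>R (fact j *\<^sub>R v))"
    using a by (intro continuous_intros continuous_on_riesz_kernel) simp
  then show ?case
    by (rule continuous_on_eq) (simp add: frac_int_monomial[OF a])
next
  case (add p q)
  from continuous_on_add[OF add.IH] show ?case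
    by (rule continuous_on_eq) (simp add: frac_int_add[OF a] continuous_on_vector_poly add.hyps)
qed

lemma frac_int_diff:
  assumes a: "0 \<le> a" and t: "0 \<le> t" and h: "continuous_on {0..t} h" "continuous_on {0..t} k"
  shows "frac_int a (\<lambda>s. h s - k s) t = frac_int a h t - frac_int a k t"
proof -
  have "frac_int a h t = frac_int a (\<lambda>s. (h s - k s) + k s) t" by simp
  also have "\<dots> = frac_int a (\<lambda>s. h s - k s) t + frac_int a k t"
    by (intro frac_int_add a t h continuous_on_diff)
  finally show ?thesis by simp
qed

text \<open>By the norm bound, fractional integration is continuous for the uniform norm on \<open>{0..T}\<close>. So the
fractional integral of \<open>h\<close> is a uniform limit of those of polynomials, which are explicit.\<close>

lemma continuous_on_frac_int:
  fixes h :: "real \<Rightarrow> 'b::banach"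
  assumes a: "0 \<le> a" and T: "0 < T" and h: "continuous_on {0..T} h"
  shows "continuous_on {0..T} (frac_int a h)"
proof -
  have "\<exists>p. vector_poly p \<and> (\<forall>s\<in>{0..T}. norm (h s - p s) < 1 / real (Suc n))" for n
    by (rule vector_poly_approximation[OF T h, of "1 / real (Suc n)"]) (simp, blast)
  then obtain p where p: "vector_poly (p n)" "\<forall>s\<in>{0..T}. norm (h s - p n s) < 1 / real (Suc n)" for n
    by metis
  have bound: "norm (frac_int a h t - frac_int a (p n) t) \<le> riesz_kernel a T * (1 / real (Suc n))"
    if t: "t \<in> {0..T}" for n t
  proof -
    have sub: "{0..t} \<subseteq> {0..T}" and t0: "0 \<le> t" using t by auto
    have c: "continuous_on {0..t} h" "continuous_on {0..t} (p n)"
      using continuous_on_subset[OF h sub] continuous_on_vector_poly[OF p(1)] by auto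
    have "norm (frac_int a h t - frac_int a (p n) t) \<le> riesz_kernel a t * (1 / real (Suc n))"
      unfolding frac_int_diff[OF a t0 c, symmetric]
      by (rule norm_frac_int_le[OF a t0 continuous_on_diff[OF c]]) (use sub p(2)[of n] in \<open>auto simp: less_imp_le\<close>)
    also have "\<dots> \<le> riesz_kernel a T * (1 / real (Suc n))"
      using t by (intro mult_right_mono riesz_kernel_mono a) auto
    finally show ?thesis .
  qed
  have "uniform_limit {0..T} (\<lambda>n. frac_int a (p n)) (frac_int a h) sequentially"
    unfolding uniform_limit_sequentially_iff dist_norm
  proof (intro allI impI)
    fix e :: real assume e: "0 < e"
    have "(\<lambda>n. riesz_kernel a T * (1 / real (Suc n))) \<longlonglongrightarrow> riesz_kernel a T * 0"
      by (intro tendsto_mult tendsto_const LIMSEQ_Suc[OF lim_1_over_n])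
    then have "eventually (\<lambda>n. riesz_kernel a T * (1 / real (Suc n)) < e) sequentially"
      using e by (intro order_tendstoD(2)) auto
    then obtain N where "\<And>n. n \<ge> N \<Longrightarrow> riesz_kernel a T * (1 / real (Suc n)) < e"
      by (auto simp: eventually_sequentially)
    then show "\<exists>N. \<forall>n\<ge>N. \<forall>t\<in>{0..T}. norm (frac_int a (p n) t - frac_int a h t) < e"
      using le_less_trans[OF bound] by (subst norm_minus_commute) blast
  qed
  then show ?thesis
    by (rule uniform_limit_theorem[rotated]) (auto intro!: always_eventually continuous_on_frac_int_vector_poly p a)
qed

lemma frac_int_frac_int_vector_poly:
  assumes p: "vector_poly p" and a: "0 \<le> a" and b: "0 \<le> b" and t: "0 \<le> t"
  shows "frac_int a (frac_int b p) t = frac_int (a + b) p t"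
  using p
proof (induction rule: vector_poly.induct)
  case (monomial j v)
  have c: "continuous_on {0..t} (\<lambda>s. riesz_kernel (real j + b) s *\<^sub>R (fact j *\<^sub>R v))"
    using b by (intro continuous_intros continuous_on_riesz_kernel) simp
  have "frac_int a (frac_int b (\<lambda>s. s ^ j *\<^sub>R v)) t
      = frac_int a (\<lambda>s. riesz_kernel (real j + b) s *\<^sub>R (fact j *\<^sub>R v)) t"
    by (cases "a = 0") (use a t in \<open>auto simp: frac_int_monomial[OF b] frac_int_def[of 0] intro!: frac_int_cong\<close>)
  also have "\<dots> = riesz_kernel (real j + b + a) t *\<^sub>R (fact j *\<^sub>R v)"
    using b by (intro frac_int_riesz_kernel a t) simp
  also have "\<dots> = frac_int (a + b) (\<lambda>s. s ^ j *\<^sub>R v) t"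
    using a b by (simp add: frac_int_monomial[OF _ t] add_ac)
  finally show ?case .
next
  case (add p q)
  note c = continuous_on_vector_poly[OF add.hyps(1)] continuous_on_vector_poly[OF add.hyps(2)]
    continuous_on_frac_int_vector_poly[OF add.hyps(1) b] continuous_on_frac_int_vector_poly[OF add.hyps(2) b]
  have "frac_int a (frac_int b (\<lambda>s. p s + q s)) t = frac_int a (\<lambda>s. frac_int b p s + frac_int b q s) t"
    by (cases "a = 0") (use a t c in \<open>auto simp: frac_int_add[OF b] frac_int_def[of 0] intro!: frac_int_cong\<close>)
  also have "\<dots> = frac_int (a + b) (\<lambda>s. p s + q s) t"
    using a b add.IH by (simp add: frac_int_add[OF _ t] c)
  finally show ?case .
qed

text \<open>The semigroup law. Both sides are linear in \<open>h\<close> and continuous for the uniform norm, so it is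
enough to know it for monomials with a vector coefficient, where it is the Beta integral.\<close>

lemma frac_int_frac_int:
  fixes h :: "real \<Rightarrow> 'b::banach"
  assumes a: "0 \<le> a" and b: "0 \<le> b" and T: "0 < T" and h: "continuous_on {0..T} h" and t: "t \<in> {0..T}"
  shows "frac_int a (frac_int b h) t = frac_int (a + b) h t"
proof -
  define C where "C = riesz_kernel a t * riesz_kernel b T + riesz_kernel (a + b) t"
  have C: "0 \<le> C" using a b by (simp add: C_def riesz_kernel_nonneg)
  have sub: "{0..t} \<subseteq> {0..T}" and t0: "0 \<le> t" using t by auto
  have "norm (frac_int a (frac_int b h) t - frac_int (a + b) h t) \<le> C * e" if e: "0 < e" for e
  proof -
    obtain p where p: "vector_poly p" and close: "\<forall>s\<in>{0..T}. norm (h s - p s) < e"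
      using vector_poly_approximation[OF T h e] .
    define d where "d s = h s - p s" for s
    have cp: "continuous_on S p" for S by (rule continuous_on_vector_poly[OF p])
    have cd: "continuous_on {0..T} d" unfolding d_def by (intro continuous_on_diff h cp)
    \<comment> \<open>the law holds for \<open>p\<close>, hence only the small remainder \<open>d\<close> contributes to the difference\<close>
    have split: "frac_int c h s = frac_int c d s + frac_int c p s" if "s \<in> {0..T}" "0 \<le> c" for c s
    proof -
      have "continuous_on {0..s} h" using that by (intro continuous_on_subset[OF h]) auto
      then have "frac_int c d s = frac_int c h s - frac_int c p s"
        using that unfolding d_def[abs_def] by (intro frac_int_diff cp) auto
      then show ?thesis by simp
    qed
    have "frac_int a (frac_int b h) t = frac_int a (\<lambda>s. frac_int b d s + frac_int b p s) t"
      by (cases "a = 0") (use a b t in \<open>auto simp: split frac_int_def[of 0] intro!: frac_int_cong\<close>)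
    also have "\<dots> = frac_int a (frac_int b d) t + frac_int a (frac_int b p) t"
      by (intro frac_int_add a t0 continuous_on_subset[OF continuous_on_frac_int[OF b T cd] sub]
          continuous_on_frac_int_vector_poly p b)
    finally have eq: "frac_int a (frac_int b h) t - frac_int (a + b) h t
        = frac_int a (frac_int b d) t - frac_int (a + b) d t"
      using split[OF t, of "a + b"] a b by (simp add: frac_int_frac_int_vector_poly[OF p a b t0])
    have "norm (frac_int a (frac_int b d) t) \<le> riesz_kernel a t * (riesz_kernel b T * e)"
    proof (rule norm_frac_int_le[OF a t0 continuous_on_subset[OF continuous_on_frac_int[OF b T cd] sub]])
      fix s assume s: "s \<in> {0..t}"
      then have s': "0 \<le> s" "{0..s} \<subseteq> {0..T}" using t by auto
      have "norm (frac_int b d s) \<le> riesz_kernel b s * e"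
        using s' close by (intro norm_frac_int_le b continuous_on_subset[OF cd]) (auto simp: d_def less_imp_le)
      also have "\<dots> \<le> riesz_kernel b T * e"
        using s t e by (intro mult_right_mono riesz_kernel_mono b) auto
      finally show "norm (frac_int b d s) \<le> riesz_kernel b T * e" .
    qed
    moreover have "norm (frac_int (a + b) d t) \<le> riesz_kernel (a + b) t * e"
      using sub close a b by (intro norm_frac_int_le t0 continuous_on_subset[OF cd]) (auto simp: d_def less_imp_le)
    ultimately show ?thesis
      using norm_triangle_ineq4[of "frac_int a (frac_int b d) t" "frac_int (a + b) d t"]
      unfolding eq
      by (simp add: C_def algebra_simps)
  qed
  then have "norm (frac_int a (frac_int b h) t - frac_int (a + b) h t) \<le> e" if "0 < e" for e
    using that C by (cases "C = 0") (fastforce dest: spec[of _ "e / C"] simp: less_le)+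
  then have "norm (frac_int a (frac_int b h) t - frac_int (a + b) h t) \<le> 0"
    by (rule field_le_epsilon[of _ 0, simplified])
  then show ?thesis by simp
qed

text \<open>The fundamental theorem of calculus, again by density: if \<open>p\<close> is a polynomial uniformly close to \<open>x'\<close>,
then \<open>x - I\<^sup>1 p\<close> has a small derivative and is therefore nearly constant.\<close>

lemma frac_int_1_deriv:
  fixes x :: "real \<Rightarrow> 'b::banach"
  assumes T: "0 < T" and x: "\<And>s. s \<in> {0..T} \<Longrightarrow> (x has_vector_derivative x' s) (at s within {0..T})"
    and x': "continuous_on {0..T} x'" and t: "t \<in> {0..T}"
  shows "frac_int 1 x' t = x t - x 0"
proof -
  have poly: "(frac_int 1 p has_vector_derivative p s) (at s within {0..T})" "frac_int 1 p 0 = 0"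
    if "vector_poly p" "s \<in> {0..T}" for p :: "real \<Rightarrow> 'b" and s
    using that
  proof (induction rule: vector_poly.induct)
    case (monomial j v)
    have eq: "frac_int 1 (\<lambda>s. s ^ j *\<^sub>R v) r = (r ^ Suc j / Suc j) *\<^sub>R v" if r: "0 \<le> r" for r
    proof -
      have "riesz_kernel (real j + 1) r = r powr real (Suc j) / Gamma (1 + real (Suc j))"
        by (simp add: riesz_kernel_def add_ac)
      also have "\<dots> = r ^ Suc j / fact (Suc j)"
        unfolding powr_realpow'[OF r Suc_not_Zero] Gamma_fact ..
      finally show ?thesis
        by (simp add: frac_int_monomial[OF zero_le_one r] del: of_nat_Suc)
    qed
    { case 1
      have "((\<lambda>r. (r ^ Suc j / Suc j) *\<^sub>R v) has_vector_derivative s ^ j *\<^sub>R v) (at s within {0..T})"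
        using has_vector_derivative_scaleR[OF _ has_vector_derivative_const, of "\<lambda>r. r ^ Suc j / Suc j" "s ^ j"]
        by (auto intro!: derivative_eq_intros simp del: of_nat_Suc power_Suc)
      then show ?case
        by (rule has_vector_derivative_transform[OF 1, rotated]) (use eq in auto)
    next
      case 2
      show ?case using eq[of 0] by simp
    }
  next
    case (add p q)
    have eq: "frac_int 1 (\<lambda>s. p s + q s) r = frac_int 1 p r + frac_int 1 q r" if "0 \<le> r" for r
      using that add.hyps by (intro frac_int_add continuous_on_vector_poly) auto
    { case 1
      have "((\<lambda>r. frac_int 1 p r + frac_int 1 q r) has_vector_derivative p s + q s) (at s within {0..T})"
        by (intro has_vector_derivative_add add 1)
      then show ?case
        by (rule has_vector_derivative_transform[OF 1, rotated]) (use eq in auto)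
    next
      case 2
      then show ?case using eq[of 0] add by simp
    }
  qed
  have sub: "{0..t} \<subseteq> {0..T}" and t0: "0 \<le> t" using t by auto
  have "norm (frac_int 1 x' t - (x t - x 0)) \<le> 2 * t * e" if e: "0 < e" for e
  proof -
    obtain p where p: "vector_poly p" and close: "\<forall>s\<in>{0..T}. norm (x' s - p s) < e"
      using vector_poly_approximation[OF T x' e] .
    have "norm ((x t - frac_int 1 p t) - (x 0 - frac_int 1 p 0)) \<le> e * norm (t - 0)"
    proof (rule differentiable_bound[of "{0..T}" _ "\<lambda>s h. h *\<^sub>R (x' s - p s)"])
      show "((\<lambda>s. x s - frac_int 1 p s) has_derivative (\<lambda>h. h *\<^sub>R (x' s - p s))) (at s within {0..T})"
        if "s \<in> {0..T}" for s
        using has_vector_derivative_diff[OF x[OF that] poly(1)[OF p that]] by (simp add: has_vector_derivative_def)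
      show "onorm (\<lambda>h. h *\<^sub>R (x' s - p s)) \<le> e" if "s \<in> {0..T}" for s
      proof (rule onorm_le)
        fix h
        have "norm (x' s - p s) \<le> e" using close that by (auto intro: less_imp_le)
        from mult_left_mono[OF this abs_ge_zero[of h]] show "norm (h *\<^sub>R (x' s - p s)) \<le> e * norm h"
          by (simp add: mult.commute[of e])
      qed
    qed (use t in auto)
    moreover have "norm (frac_int 1 x' t - frac_int 1 p t) \<le> riesz_kernel 1 t * e"
    proof -
      have c: "continuous_on {0..t} x'" "continuous_on {0..t} p"
        using continuous_on_subset[OF x' sub] continuous_on_vector_poly[OF p] by auto
      show ?thesis
        unfolding frac_int_diff[OF zero_le_one t0 c, symmetric]
        by (rule norm_frac_int_le[OF zero_le_one t0 continuous_on_diff[OF c]]) (use sub close in \<open>auto simp: less_imp_le\<close>)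
    qed
    moreover have "frac_int 1 p 0 = 0" using poly(2)[OF p, of 0] T by simp
    moreover have "riesz_kernel 1 t = t" using t0 Gamma_fact[of 1, where 'a = real] by (simp add: riesz_kernel_def)
    ultimately show ?thesis
      using norm_triangle_ineq4[of "frac_int 1 x' t - frac_int 1 p t" "(x t - frac_int 1 p t) - x 0"] t0
      by (simp add: algebra_simps)
  qed
  from this[of "e / (2 * T)" for e]
  have "norm (frac_int 1 x' t - (x t - x 0)) \<le> e" if "0 < e" for e
  proof -
    have "norm (frac_int 1 x' t - (x t - x 0)) \<le> 2 * t * (e / (2 * T))"
      using that T \<open>\<And>e. 0 < e / (2 * T) \<Longrightarrow> norm (frac_int 1 x' t - (x t - x 0)) \<le> 2 * t * (e / (2 * T))\<close> by simp
    also have "\<dots> \<le> e" using that t T by (simp add: field_simps)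
    finally show ?thesis .
  qed
  then have "norm (frac_int 1 x' t - (x t - x 0)) \<le> 0"
    by (rule field_le_epsilon[of _ 0, simplified])
  then show ?thesis by simp
qed

section \<open>The operators Q\<close>

lemma blinfun_compose_assoc: "(F o\<^sub>L G) o\<^sub>L H = F o\<^sub>L (G o\<^sub>L H)"
  by (rule blinfun_eqI) simp

lemma Qop_0: "Qop A B 0 m = blinfun_pow B m"
  by (cases m) (simp_all add: blinfun_pow_def)

lemma Qop_Suc_left: "Qop A B k (Suc m) = (\<Sum>l\<le>k. blinfun_pow A (k - l) o\<^sub>L B o\<^sub>L Qop A B l m)"
  by (cases k) (auto simp: Qop_0 blinfun_pow_def intro!: blinfun_eqI)

lemma Qop_Suc_Suc: "Qop A B (Suc k) (Suc m) = (A o\<^sub>L Qop A B k (Suc m)) + (B o\<^sub>L Qop A B (Suc k) m)"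
proof -
  have "Qop A B (Suc k) (Suc m) = (\<Sum>l\<le>k. blinfun_pow A (Suc k - l) o\<^sub>L B o\<^sub>L Qop A B l m)
      + (blinfun_pow A 0 o\<^sub>L B o\<^sub>L Qop A B (Suc k) m)"
    by (simp add: Qop_Suc_left)
  also have "(\<Sum>l\<le>k. blinfun_pow A (Suc k - l) o\<^sub>L B o\<^sub>L Qop A B l m) = A o\<^sub>L Qop A B k (Suc m)"
    unfolding Qop_Suc_left bounded_bilinear.sum_right[OF bounded_bilinear_blinfun_compose]
    by (intro sum.cong refl) (simp add: blinfun_pow_def Suc_diff_le blinfun_compose_assoc)
  also have "blinfun_pow A 0 o\<^sub>L B o\<^sub>L Qop A B (Suc k) m = B o\<^sub>L Qop A B (Suc k) m"
    by (rule blinfun_eqI) (simp add: blinfun_pow_def)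
  finally show ?thesis .
qed

text \<open>\<open>Qop A B k m\<close> is the sum of all products of \<open>k\<close> factors \<open>A\<close> and \<open>m\<close> factors \<open>B\<close> in any order. The
recursion splits these products according to their first factor.\<close>

lemma Qop_eq:
  assumes "(k, m) \<noteq> (0, 0)"
  shows "Qop A B k m = (if k = 0 then 0 else A o\<^sub>L Qop A B (k - 1) m) + (if m = 0 then 0 else B o\<^sub>L Qop A B k (m - 1))"
  using assms by (cases k; cases m) (simp_all add: Qop_0 Qop_Suc_Suc blinfun_pow_def del: Qop.simps(2,3))

lemma norm_Qop_le: "norm (Qop A B k m) \<le> (norm A + norm B) ^ (k + m)"
proof (induction "k + m" arbitrary: k m)
  case 0
  then show ?case by (simp add: blinfun_pow_def norm_blinfun_id_le)
next
  case (Suc n)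
  have "norm (if k = 0 then 0 else A o\<^sub>L Qop A B (k - 1) m) \<le> norm A * (norm A + norm B) ^ n"
  proof (cases "k = 0")
    case False
    then have "n = k - 1 + m" using Suc.hyps(2) by simp
    from Suc.hyps(1)[OF this, folded this] False show ?thesis
      by (auto intro!: order_trans[OF norm_blinfun_compose] mult_left_mono)
  qed simp
  moreover have "norm (if m = 0 then 0 else B o\<^sub>L Qop A B k (m - 1)) \<le> norm B * (norm A + norm B) ^ n"
  proof (cases "m = 0")
    case False
    then have "n = k + (m - 1)" using Suc.hyps(2) by simp
    from Suc.hyps(1)[OF this, folded this] False show ?thesis
      by (auto intro!: order_trans[OF norm_blinfun_compose] mult_left_mono)
  qed simp
  moreover have "(k, m) \<noteq> (0, 0)" using Suc.hyps(2) by auto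
  ultimately have "norm (Qop A B k m) \<le> norm A * (norm A + norm B) ^ n + norm B * (norm A + norm B) ^ n"
    unfolding Qop_eq[OF \<open>(k, m) \<noteq> (0, 0)\<close>] by (intro order_trans[OF norm_triangle_ineq] add_mono)
  then show ?case by (simp add: Suc.hyps(2)[symmetric] algebra_simps)
qed

section \<open>Double series\<close>

text \<open>Iterating the integral equation \<open>n\<close> times produces exactly the terms with \<open>k + m = n\<close>.\<close>

definition diagonal_sum :: "(nat \<Rightarrow> nat \<Rightarrow> 'c::comm_monoid_add) \<Rightarrow> nat \<Rightarrow> 'c" where
  "diagonal_sum F n = (\<Sum>k\<le>n. F k (n - k))"

lemma summable_Suc_times_half_power: "summable (\<lambda>n. C * (real (Suc n) * (1 / 2) ^ n))"
  using geometric_deriv_sums[of "1 / 2 :: real"] by (intro summable_mult) (auto simp: sums_iff)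

lemma norm_diagonal_sum_le:
  fixes F :: "nat \<Rightarrow> nat \<Rightarrow> 'c::real_normed_vector"
  assumes "\<And>k m. norm (F k m) \<le> C * (1 / 2) ^ (k + m)"
  shows "norm (diagonal_sum F n) \<le> C * (real (Suc n) * (1 / 2) ^ n)"
proof -
  have "norm (diagonal_sum F n) \<le> (\<Sum>k\<le>n. C * (1 / 2) ^ n)"
    unfolding diagonal_sum_def
  proof (rule sum_norm_le)
    fix k assume "k \<in> {..n}"
    then show "norm (F k (n - k)) \<le> C * (1 / 2) ^ n" using assms[of k "n - k"] by simp
  qed
  then show ?thesis by (simp add: algebra_simps)
qed

text \<open>The bound makes the family absolutely summable over all pairs, so that summation by rows and
summation by diagonals are two ways of grouping the same sum.\<close>

lemma double_series_diagonal:
  fixes F :: "nat \<Rightarrow> nat \<Rightarrow> 'c::banach"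
  assumes F: "\<And>k m. norm (F k m) \<le> C * (1 / 2) ^ (k + m)"
  shows "double_summable F" and "diagonal_sum F sums (\<Sum>k. \<Sum>m. F k m)"
proof -
  have geo: "((\<lambda>n. c * (1 / 2) ^ n) has_sum c * 2) (UNIV :: nat set)" for c :: real
  proof (rule norm_summable_imp_has_sum)
    show "(\<lambda>n. c * (1 / 2) ^ n) sums (c * 2)"
      using geometric_sums[of "1 / 2 :: real"] by (intro sums_mult) simp
    show "summable (\<lambda>n. norm (c * (1 / 2) ^ n))"
      by (simp add: abs_mult summable_mult)
  qed
  have row: "summable (\<lambda>m. norm (F k m))" for k
  proof (rule summable_comparison_test[OF exI[of _ 0]])
    show "summable (\<lambda>m. C * (1 / 2) ^ k * (1 / 2) ^ m)" by (intro summable_mult) simp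
  qed (use F[of k] in \<open>simp add: power_add mult.assoc\<close>)
  have "(\<lambda>(k, m). C * (1 / 2) ^ (k + m)) summable_on (UNIV \<times> UNIV :: (nat \<times> nat) set)"
  proof (rule abs_summable_summable)
    have C0: "0 \<le> C" using order_trans[OF norm_ge_zero F[of 0 0]] by simp
    have "((\<lambda>m. norm (C * (1 / 2) ^ (k + m))) has_sum (C * 2) * (1 / 2) ^ k) UNIV" for k
      using geo[of "C * (1 / 2) ^ k"] C0 by (simp add: power_add mult_ac abs_mult)
    then have "(\<lambda>m. norm (C * (1 / 2) ^ (k + m))) summable_on UNIV"
      "infsum (\<lambda>m. norm (C * (1 / 2) ^ (k + m))) UNIV = (C * 2) * (1 / 2) ^ k" for k
      by (auto simp: summable_on_def infsumI)
    moreover have "(\<lambda>k. norm ((C * 2) * (1 / 2) ^ k)) summable_on (UNIV :: nat set)"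
      using geo[of "C * 2"] C0 by (auto simp: abs_mult summable_on_def)
    ultimately show "(\<lambda>x. norm ((\<lambda>(k, m). C * (1 / 2) ^ (k + m)) x)) summable_on (UNIV \<times> UNIV)"
      unfolding Infinite_Sum.abs_summable_on_Sigma_iff by simp
  qed
  then have "(\<lambda>x. norm (case_prod F x)) summable_on (UNIV \<times> UNIV)"
    by (rule summable_on_comparison_test) (use F in auto)
  then have "case_prod F summable_on (UNIV \<times> UNIV)"
    by (rule abs_summable_summable)
  then obtain S where S: "(case_prod F has_sum S) (UNIV \<times> UNIV)"
    by (auto simp: summable_on_def)
  have "((\<lambda>m. case_prod F (k, m)) has_sum (\<Sum>m. F k m)) UNIV" for k
    using norm_summable_imp_has_sum[OF row summable_sums[OF summable_norm_cancel[OF row]]] by simp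
  from has_sum_SigmaD[OF S this] have rows: "(\<lambda>k. \<Sum>m. F k m) sums S"
    by (rule has_sum_imp_sums)
  have "((\<lambda>(n, k). F k (n - k)) has_sum S) (SIGMA n:UNIV. {..n})"
    by (subst has_sum_reindex_bij_witness[where T = "UNIV \<times> UNIV" and h = "case_prod F" and s' = S
          and j = "\<lambda>(n, k). (k, n - k)" and i = "\<lambda>(k, m). (k + m, k)"]) (use S in auto)
  from has_sum_SigmaD[OF this, of "diagonal_sum F"] have diag: "diagonal_sum F sums S"
    by (intro has_sum_imp_sums) (simp add: diagonal_sum_def)
  show "double_summable F"
    using summable_norm_cancel[OF row] rows by (auto simp: double_summable_def sums_iff)
  show "diagonal_sum F sums (\<Sum>k. \<Sum>m. F k m)"
    using diag rows by (simp add: sums_iff)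
qed

section \<open>The bivariate Mittag-Leffler function\<close>

text \<open>Restrict Euler's integral to \<open>{L..}\<close>, where the power is at least \<open>L powr (x - 1)\<close>. As \<open>L\<close> is free, the
Gamma function grows faster than every exponential.\<close>

lemma Gamma_ge_powr:
  fixes x L :: real
  assumes x: "1 \<le> x" and L: "0 < L"
  shows "L powr (x - 1) * exp (- L) \<le> Gamma x"
proof -
  have "((\<lambda>t. L powr (x - 1) * exp (- 1 * t)) has_integral L powr (x - 1) * (exp (- 1 * L) / 1)) {L..}"
    by (intro has_integral_mult_right has_integral_exp_minus_to_infinity) simp
  then have "((\<lambda>t. if t \<in> {L..} then L powr (x - 1) * exp (- 1 * t) else 0)
      has_integral L powr (x - 1) * (exp (- 1 * L) / 1)) {0..}"
    by (subst has_integral_restrict) (use L in auto)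
  moreover have "((\<lambda>t. t powr (x - 1) / exp t) has_integral Gamma x) {0..}"
    using x by (intro Gamma_integral_real) simp
  ultimately have "L powr (x - 1) * (exp (- 1 * L) / 1) \<le> Gamma x"
  proof (rule has_integral_le)
    fix t :: real assume "t \<in> {0..}"
    then show "(if t \<in> {L..} then L powr (x - 1) * exp (- 1 * t) else 0) \<le> t powr (x - 1) / exp t"
      using x L by (auto simp: exp_minus divide_inverse intro!: mult_right_mono powr_mono2)
  qed
  then show ?thesis by simp
qed

text \<open>The scalar factor of a term of the Mittag-Leffler series; up to a power of \<open>t\<close> it is also the
value of a fractional integral of a constant.\<close>

definition ml_weight :: "real \<Rightarrow> real \<Rightarrow> real \<Rightarrow> real \<Rightarrow> nat \<Rightarrow> nat \<Rightarrow> real" where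
  "ml_weight a b c t k m =
     (if k = 0 \<and> m = 0 then 1 else t powr (real k * a + real m * b)) / Gamma (real k * a + real m * b + c)"

lemma ml_weight_nonneg: "0 < a \<Longrightarrow> 0 < b \<Longrightarrow> 0 < c \<Longrightarrow> 0 \<le> ml_weight a b c t k m"
  unfolding ml_weight_def
  by (intro divide_nonneg_pos Gamma_real_pos) (auto intro: add_nonneg_pos)

text \<open>Use the lower bound of the Gamma function with \<open>L = T M\<close>. Then \<open>t\<close> raised to \<open>X = k a + m b\<close>, divided by
Gamma, is at most a constant times \<open>M powr (- X)\<close>, and \<open>M\<close> is chosen such that both \<open>M powr a\<close> and \<open>M powr b\<close>
are at least \<open>2 R + 1\<close>. This absorbs \<open>R ^ (k + m)\<close> and still leaves a geometric factor.\<close>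

lemma ml_weight_bound:
  assumes a: "0 < a" and b: "0 < b" and c: "1 \<le> c" and T: "0 < T" and R: "0 \<le> R"
  obtains C where "0 \<le> C"
    "\<forall>t\<in>{0..T}. \<forall>k m. R ^ (k + m) * ml_weight a b c t k m \<le> C * (1 / 2) ^ (k + m)"
proof -
  define d where "d = min a b"
  define M where "M = (2 * R + 1) powr (1 / d)"
  define L where "L = T * M"
  have d: "0 < d" "d \<le> a" "d \<le> b" using a b by (auto simp: d_def)
  have M1: "1 \<le> M" unfolding M_def using R d by (intro ge_one_powr_ge_zero) auto
  have L: "0 < L" using T M1 by (simp add: L_def)
  have Md: "M powr d = 2 * R + 1" using d R by (simp add: M_def powr_powr)
  have M: "2 * R + 1 \<le> M powr a" "2 * R + 1 \<le> M powr b"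
    using powr_mono[OF d(2) M1] powr_mono[OF d(3) M1] Md by auto
  define C where "C = exp L / L powr (c - 1)"
  have C: "0 \<le> C" by (simp add: C_def)
  have "R ^ (k + m) * ml_weight a b c t k m \<le> C * (1 / 2) ^ (k + m)" if t: "t \<in> {0..T}" for t k m
  proof -
    define X where "X = real k * a + real m * b"
    have X: "0 \<le> X" using a b by (simp add: X_def)
    have "(if k = 0 \<and> m = 0 then 1 else t powr X) \<le> T powr X"
      using t T X by (auto simp: X_def intro!: powr_mono2)
    moreover have G: "L powr (X + c - 1) * exp (- L) \<le> Gamma (X + c)"
      using Gamma_ge_powr[of "X + c" L] X c L by simp
    moreover have "0 < L powr (X + c - 1) * exp (- L)" using L by simp
    ultimately have "ml_weight a b c t k m \<le> T powr X / (L powr (X + c - 1) * exp (- L))"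
      unfolding ml_weight_def X_def[symmetric] by (intro frac_le) auto
    also have "L powr (X + c - 1) = T powr X * M powr X * L powr (c - 1)"
      using T M1 powr_add[of L X "c - 1"] by (simp add: L_def powr_mult add_diff_eq)
    also have "T powr X / (T powr X * M powr X * L powr (c - 1) * exp (- L)) = C / M powr X"
      using T L by (simp add: C_def exp_minus field_simps)
    also have "M powr X = (M powr a) ^ k * (M powr b) ^ m"
      using M1 by (simp add: X_def powr_add powr_powr[symmetric] powr_realpow mult.commute[of "real _"])
    also have "C / \<dots> \<le> C / (2 * R + 1) ^ (k + m)"
      unfolding power_add using M R C M1 by (intro divide_left_mono mult_mono power_mono mult_pos_pos zero_less_power) auto
    finally have "R ^ (k + m) * ml_weight a b c t k m \<le> R ^ (k + m) * (C / (2 * R + 1) ^ (k + m))"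
      using R by (intro mult_left_mono) auto
    also have "\<dots> = C * (R / (2 * R + 1)) ^ (k + m)" by (simp add: power_divide)
    also have "\<dots> \<le> C * (1 / 2) ^ (k + m)"
      using R C by (intro mult_left_mono power_mono) (auto simp: field_simps)
    finally show ?thesis .
  qed
  then show ?thesis using that C by blast
qed

lemma norm_mittag_leffler_term_bound:
  assumes a: "0 < a" and b: "0 < b" and c: "1 \<le> c" and T: "0 < T"
  obtains C where "0 \<le> C"
    "\<forall>t\<in>{0..T}. \<forall>k m. norm (mittag_leffler_term A B a b c t k m) \<le> C * (1 / 2) ^ (k + m)"
proof -
  obtain C where C: "0 \<le> C"
    "\<forall>t\<in>{0..T}. \<forall>k m. (norm A + norm B) ^ (k + m) * ml_weight a b c t k m \<le> C * (1 / 2) ^ (k + m)"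
    using ml_weight_bound[OF a b c T, of "norm A + norm B"] by auto
  have "norm (mittag_leffler_term A B a b c t k m) \<le> C * (1 / 2) ^ (k + m)" if "t \<in> {0..T}" for t k m
  proof -
    have w: "0 \<le> ml_weight a b c t k m" using a b c by (intro ml_weight_nonneg) auto
    have "norm (mittag_leffler_term A B a b c t k m) = ml_weight a b c t k m * norm (Qop A B k m)"
      using w by (simp add: mittag_leffler_term_def ml_weight_def[symmetric])
    also have "\<dots> \<le> ml_weight a b c t k m * (norm A + norm B) ^ (k + m)"
      by (intro mult_left_mono norm_Qop_le w)
    also have "\<dots> = (norm A + norm B) ^ (k + m) * ml_weight a b c t k m" by (rule mult.commute)
    also have "\<dots> \<le> C * (1 / 2) ^ (k + m)" using C(2) that by blast
    finally show ?thesis .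
  qed
  then show ?thesis using that C(1) by blast
qed

text \<open>The geometric bound is uniform in \<open>t\<close>, so the diagonal sums converge uniformly on \<open>{0..T}\<close> by the
Weierstrass test, and the continuity of the terms carries over to the sum.\<close>

lemma mittag_leffler_series:
  fixes A B :: "'b::banach \<Rightarrow>\<^sub>L 'b"
  assumes a: "0 < a" and b: "0 < b" and c: "1 \<le> c" and T: "0 < T"
  shows "t \<in> {0..T} \<Longrightarrow> double_summable (mittag_leffler_term A B a b c t)"
    and "t \<in> {0..T} \<Longrightarrow> diagonal_sum (mittag_leffler_term A B a b c t) sums mittag_leffler A B a b c t"
    and "uniform_limit {0..T} (\<lambda>N t. \<Sum>n<N. diagonal_sum (mittag_leffler_term A B a b c t) n)
           (mittag_leffler A B a b c) sequentially"
    and "continuous_on {0..T} (\<lambda>t. diagonal_sum (mittag_leffler_term A B a b c t) n)"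
    and "continuous_on {0..T} (mittag_leffler A B a b c)"
proof -
  obtain C where C: "0 \<le> C"
    "\<forall>t\<in>{0..T}. \<forall>k m. norm (mittag_leffler_term A B a b c t k m) \<le> C * (1 / 2) ^ (k + m)"
    by (rule norm_mittag_leffler_term_bound[OF a b c T])
  have C': "norm (mittag_leffler_term A B a b c t k m) \<le> C * (1 / 2) ^ (k + m)" if "t \<in> {0..T}" for t k m
    using C(2) that by blast
  show "double_summable (mittag_leffler_term A B a b c t)" if "t \<in> {0..T}" for t
    by (rule double_series_diagonal(1)[OF C'[OF that]])
  show sums: "diagonal_sum (mittag_leffler_term A B a b c t) sums mittag_leffler A B a b c t" if "t \<in> {0..T}" for t
    unfolding mittag_leffler_def by (rule double_series_diagonal(2)[OF C'[OF that]])
  have "uniform_limit {0..T} (\<lambda>N t. \<Sum>n<N. diagonal_sum (mittag_leffler_term A B a b c t) n)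
      (\<lambda>t. suminf (diagonal_sum (mittag_leffler_term A B a b c t))) sequentially"
    by (rule Weierstrass_m_test[OF _ summable_Suc_times_half_power]) (rule norm_diagonal_sum_le[OF C'])
  then show lim: "uniform_limit {0..T} (\<lambda>N t. \<Sum>n<N. diagonal_sum (mittag_leffler_term A B a b c t) n)
      (mittag_leffler A B a b c) sequentially"
    by (rule uniform_limit_cong'[THEN iffD1, rotated -1]) (use sums in \<open>auto simp: sums_iff\<close>)
  have terms: "continuous_on {0..T} (\<lambda>t. mittag_leffler_term A B a b c t k m)" for k m
  proof (cases "k = 0 \<and> m = 0")
    case False
    then have "0 < real k * a + real m * b" using a b by (auto intro: add_pos_nonneg add_nonneg_pos)
    moreover from this c have "Gamma (real k * a + real m * b + c) \<noteq> 0" by (intro Gamma_real_neq_0) simp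
    ultimately show ?thesis
      unfolding mittag_leffler_term_def using False
      by (auto intro!: continuous_intros continuous_on_powr')
  qed (simp add: mittag_leffler_term_def)
  show diag: "continuous_on {0..T} (\<lambda>t. diagonal_sum (mittag_leffler_term A B a b c t) n)" for n
    unfolding diagonal_sum_def by (intro continuous_intros terms)
  show "continuous_on {0..T} (mittag_leffler A B a b c)"
    by (rule uniform_limit_theorem[OF _ lim]) (auto intro!: always_eventually continuous_intros diag)
qed

section \<open>Volterra equations with two fractional integrals\<close>

lemma diagonal_sum_Suc:
  assumes "\<And>k m. (k, m) \<noteq> (0, 0) \<Longrightarrow>
    F k m = (if k = 0 then 0 else G (k - 1) m) + (if m = 0 then 0 else H k (m - 1))"
  shows "diagonal_sum F (Suc n) = diagonal_sum G n + diagonal_sum H n"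
proof -
  have "diagonal_sum F (Suc n)
      = (\<Sum>k\<le>Suc n. (if k = 0 then 0 else G (k - 1) (Suc n - k)) + (if Suc n - k = 0 then 0 else H k (Suc n - k - 1)))"
    unfolding diagonal_sum_def by (rule sum.cong[OF refl], rule assms) auto
  also have "\<dots> = (\<Sum>k\<le>Suc n. if k = 0 then 0 else G (k - 1) (Suc n - k))
      + (\<Sum>k\<le>Suc n. if Suc n - k = 0 then 0 else H k (Suc n - k - 1))"
    by (rule sum.distrib)
  also have "(\<Sum>k\<le>Suc n. if k = 0 then 0 else G (k - 1) (Suc n - k)) = diagonal_sum G n"
    unfolding sum.atMost_Suc_shift diagonal_sum_def by simp
  also have "(\<Sum>k\<le>Suc n. if Suc n - k = 0 then 0 else H k (Suc n - k - 1)) = diagonal_sum H n"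
    unfolding sum.atMost_Suc diagonal_sum_def by (auto intro!: sum.cong)
  finally show ?thesis .
qed

text \<open>The \<open>n\<close>-th power of the operator \<open>h \<mapsto> A (I\<^sup>a h) + B (I\<^sup>b h)\<close>, where \<open>I\<^sup>c\<close> is the fractional integral of
order \<open>c\<close>: fractional integrals commute with \<open>A\<close> and \<open>B\<close> and add up their orders, so all products with
\<open>k\<close> factors \<open>A\<close> and \<open>m\<close> factors \<open>B\<close> meet the same fractional integral of \<open>h\<close>.\<close>

definition iterated_frac_int ::
  "('b::banach \<Rightarrow>\<^sub>L 'b) \<Rightarrow> ('b \<Rightarrow>\<^sub>L 'b) \<Rightarrow> real \<Rightarrow> real \<Rightarrow> nat \<Rightarrow> (real \<Rightarrow> 'b) \<Rightarrow> real \<Rightarrow> 'b" where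
  "iterated_frac_int A B a b n h t =
     diagonal_sum (\<lambda>k m. Qop A B k m (frac_int (real k * a + real m * b) h t)) n"

lemma continuous_on_blinfun_apply: "continuous_on S h \<Longrightarrow> continuous_on S (\<lambda>s. blinfun_apply L (h s))"
  by (rule bounded_linear.continuous_on[OF blinfun.bounded_linear_right])

lemma continuous_on_iterated_frac_int:
  assumes "0 < a" and "0 < b" and T: "0 < T" and h: "continuous_on {0..T} h"
  shows "continuous_on {0..T} (iterated_frac_int A B a b n h)"
  unfolding iterated_frac_int_def diagonal_sum_def
  using assms by (intro continuous_on_sum continuous_on_blinfun_apply continuous_on_frac_int[OF _ T h]) auto

lemma iterated_frac_int_0: "iterated_frac_int A B a b 0 h t = h t"
  by (simp add: iterated_frac_int_def diagonal_sum_def blinfun_pow_def frac_int_def)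

lemma frac_int_iterated_frac_int:
  assumes a: "0 < a" and b: "0 < b" and c: "0 \<le> c" and T: "0 < T"
    and h: "continuous_on {0..T} h" and t: "t \<in> {0..T}"
  shows "frac_int c (iterated_frac_int A B a b n h) t
    = diagonal_sum (\<lambda>k m. Qop A B k m (frac_int (c + (real k * a + real m * b)) h t)) n"
proof -
  have nonneg: "0 \<le> real k * a + real m * b" for k m using a b by simp
  have t0: "0 \<le> t" and sub: "{0..t} \<subseteq> {0..T}" using t by auto
  have cont: "continuous_on {0..t} (frac_int (real k * a + real m * b) h)" for k m
    by (rule continuous_on_subset[OF continuous_on_frac_int[OF nonneg T h] sub])
  have "frac_int c (iterated_frac_int A B a b n h) t
      = (\<Sum>k\<le>n. frac_int c (\<lambda>s. Qop A B k (n - k) (frac_int (real k * a + real (n - k) * b) h s)) t)"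
    unfolding iterated_frac_int_def[abs_def] diagonal_sum_def
    by (rule frac_int_sum[OF c t0]) (rule finite_atMost, rule continuous_on_blinfun_apply[OF cont])
  also have "\<dots> = (\<Sum>k\<le>n. Qop A B k (n - k) (frac_int c (frac_int (real k * a + real (n - k) * b) h) t))"
    by (intro sum.cong refl frac_int_bounded_linear[OF blinfun.bounded_linear_right c t0] cont)
  also have "\<dots> = (\<Sum>k\<le>n. Qop A B k (n - k) (frac_int (c + (real k * a + real (n - k) * b)) h t))"
    by (intro sum.cong refl arg_cong[where f = "blinfun_apply _"] frac_int_frac_int[OF c nonneg T h t])
  finally show ?thesis by (simp add: diagonal_sum_def)
qed

text \<open>One more factor in front is what the recursion of \<open>Qop\<close> by the first factor describes.\<close>

lemma iterated_frac_int_Suc: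
  assumes a: "0 < a" and b: "0 < b" and T: "0 < T" and h: "continuous_on {0..T} h" and t: "t \<in> {0..T}"
  shows "A (frac_int a (iterated_frac_int A B a b n h) t) + B (frac_int b (iterated_frac_int A B a b n h) t)
    = iterated_frac_int A B a b (Suc n) h t"
proof -
  let ?P = "\<lambda>k m. frac_int (real k * a + real m * b) h t"
  have "iterated_frac_int A B a b (Suc n) h t
      = diagonal_sum (\<lambda>k m. A (Qop A B k m (frac_int (a + (real k * a + real m * b)) h t))) n
      + diagonal_sum (\<lambda>k m. B (Qop A B k m (frac_int (b + (real k * a + real m * b)) h t))) n"
    unfolding iterated_frac_int_def
  proof (rule diagonal_sum_Suc)
    fix k m :: nat assume km: "(k, m) \<noteq> (0, 0)"
    have A: "blinfun_apply (if k = 0 then 0 else A o\<^sub>L Qop A B (k - 1) m) (?P k m)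
      = (if k = 0 then 0 else A (Qop A B (k - 1) m (frac_int (a + (real (k - 1) * a + real m * b)) h t)))"
    proof (cases "k = 0")
      case False
      then have "a + (real (k - 1) * a + real m * b) = real k * a + real m * b"
        by (cases k) (auto simp: algebra_simps)
      then show ?thesis by (simp only:) (simp add: False)
    qed simp
    have B: "blinfun_apply (if m = 0 then 0 else B o\<^sub>L Qop A B k (m - 1)) (?P k m)
      = (if m = 0 then 0 else B (Qop A B k (m - 1) (frac_int (b + (real k * a + real (m - 1) * b)) h t)))"
    proof (cases "m = 0")
      case False
      then have "b + (real k * a + real (m - 1) * b) = real k * a + real m * b"
        by (cases m) (auto simp: algebra_simps)
      then show ?thesis by (simp only:) (simp add: False)
    qed simp
    show "Qop A B k m (?P k m)
      = (if k = 0 then 0 else A (Qop A B (k - 1) m (frac_int (a + (real (k - 1) * a + real m * b)) h t)))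
      + (if m = 0 then 0 else B (Qop A B k (m - 1) (frac_int (b + (real k * a + real (m - 1) * b)) h t)))"
      unfolding A[symmetric] B[symmetric] Qop_eq[OF km] by (rule blinfun.add_left)
  qed
  then show ?thesis
    using frac_int_iterated_frac_int[OF a b _ T h t, of a A B n] frac_int_iterated_frac_int[OF a b _ T h t, of b A B n] a b
    by (simp add: diagonal_sum_def blinfun.sum_right)
qed

text \<open>Picard iteration: the equation is substituted into itself \<open>N\<close> times.\<close>

lemma volterra_iterate:
  fixes A B :: "'b::banach \<Rightarrow>\<^sub>L 'b"
  assumes a: "0 < a" and b: "0 < b" and T: "0 < T"
    and u: "continuous_on {0..T} u" and f: "continuous_on {0..T} f"
    and eq: "\<And>t. t \<in> {0..T} \<Longrightarrow> u t = A (frac_int a u t) + B (frac_int b u t) + f t"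
    and t: "t \<in> {0..T}"
  shows "u t = (\<Sum>n<N. iterated_frac_int A B a b n f t) + iterated_frac_int A B a b N u t"
  using t
proof (induction N arbitrary: t)
  case 0
  show ?case by (simp add: iterated_frac_int_0)
next
  case (Suc N)
  let ?W = "\<lambda>n h. iterated_frac_int A B a b n h"
  have t0: "0 \<le> t" and sub: "{0..t} \<subseteq> {0..T}" using Suc.prems by auto
  have cont: "continuous_on {0..t} (?W n h)" if "continuous_on {0..T} h" for n h
    by (rule continuous_on_subset[OF continuous_on_iterated_frac_int[OF a b T that] sub])
  have step: "frac_int c u t = (\<Sum>n<N. frac_int c (?W n f) t) + frac_int c (?W N u) t" if c: "0 < c" for c
  proof -
    have c0: "0 \<le> c" using c by simp
    have "frac_int c u t = frac_int c (\<lambda>s. (\<Sum>n<N. ?W n f s) + ?W N u s) t"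
      using Suc.IH Suc.prems by (intro frac_int_cong[OF c]) auto
    also have "\<dots> = frac_int c (\<lambda>s. \<Sum>n<N. ?W n f s) t + frac_int c (?W N u) t"
      by (intro frac_int_add[OF c0 t0] continuous_on_sum cont f u)
    also have "frac_int c (\<lambda>s. \<Sum>n<N. ?W n f s) t = (\<Sum>n<N. frac_int c (?W n f) t)"
      by (intro frac_int_sum[OF c0 t0] cont f) simp
    finally show ?thesis .
  qed
  have "u t = f t + (\<Sum>n<N. A (frac_int a (?W n f) t) + B (frac_int b (?W n f) t))
      + (A (frac_int a (?W N u) t) + B (frac_int b (?W N u) t))"
    using eq[OF Suc.prems] step[OF a] step[OF b]
    by (simp add: blinfun.add_right blinfun.sum_right sum.distrib algebra_simps)
  also have "\<dots> = ?W 0 f t + (\<Sum>n<N. ?W (Suc n) f t) + ?W (Suc N) u t"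
    by (simp only: iterated_frac_int_0 iterated_frac_int_Suc[OF a b T f Suc.prems] iterated_frac_int_Suc[OF a b T u Suc.prems])
  finally show ?case by (simp only: sum.lessThan_Suc_shift)
qed

lemma riesz_kernel_eq_ml_weight:
  assumes a: "0 < a" and b: "0 < b" and t: "0 \<le> t"
  shows "riesz_kernel (real k * a + real m * b) t = ml_weight a b 1 t k m"
    and "0 < c \<Longrightarrow> riesz_kernel (real k * a + real m * b + c) t = t powr c * ml_weight a b (c + 1) t k m"
proof -
  have X: "real k * a + real m * b = 0 \<longleftrightarrow> k = 0 \<and> m = 0"
    using a b by (simp add: add_nonneg_eq_0_iff)
  then show "riesz_kernel (real k * a + real m * b) t = ml_weight a b 1 t k m"
    by (simp add: riesz_kernel_def ml_weight_def)
  assume c: "0 < c"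
  have "0 \<le> real k * a + real m * b" using a b by simp
  then have "real k * a + real m * b + c \<noteq> 0" using c by linarith
  then show "riesz_kernel (real k * a + real m * b + c) t = t powr c * ml_weight a b (c + 1) t k m"
    by (simp add: riesz_kernel_def ml_weight_def powr_add add.assoc)
qed

text \<open>The \<open>n\<close>-th diagonal has \<open>n + 1\<close> summands, and the growth of the Gamma function makes each of them
at most a constant times \<open>(1/2) ^ n\<close>.\<close>

lemma iterated_frac_int_tendsto_0:
  fixes A B :: "'b::banach \<Rightarrow>\<^sub>L 'b"
  assumes a: "0 < a" and b: "0 < b" and T: "0 < T" and h: "continuous_on {0..T} h" and t: "t \<in> {0..T}"
  shows "(\<lambda>n. iterated_frac_int A B a b n h t) \<longlonglongrightarrow> 0"
proof -
  obtain M where M: "0 \<le> M" "\<forall>s\<in>{0..T}. norm (h s) \<le> M"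
    using continuous_on_Icc_bounded[OF h] .
  obtain C where C: "0 \<le> C"
    "\<forall>t\<in>{0..T}. \<forall>k m. (norm A + norm B) ^ (k + m) * ml_weight a b 1 t k m \<le> C * (1 / 2) ^ (k + m)"
    using ml_weight_bound[OF a b order_refl T, of "norm A + norm B"] by auto
  have t0: "0 \<le> t" and sub: "{0..t} \<subseteq> {0..T}" using t by auto
  have term_le: "norm (Qop A B k m (frac_int (real k * a + real m * b) h t)) \<le> C * M * (1 / 2) ^ (k + m)" for k m
  proof -
    have w: "0 \<le> ml_weight a b 1 t k m" using a b by (intro ml_weight_nonneg) auto
    have X: "0 \<le> real k * a + real m * b" using a b by simp
    have "norm (Qop A B k m (frac_int (real k * a + real m * b) h t))
        \<le> norm (Qop A B k m) * norm (frac_int (real k * a + real m * b) h t)"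
      by (rule norm_blinfun)
    also have "\<dots> \<le> (norm A + norm B) ^ (k + m) * (ml_weight a b 1 t k m * M)"
    proof (intro mult_mono norm_Qop_le)
      show "norm (frac_int (real k * a + real m * b) h t) \<le> ml_weight a b 1 t k m * M"
        using norm_frac_int_le[OF X t0 continuous_on_subset[OF h sub], of M] M(2) sub
        by (auto simp: riesz_kernel_eq_ml_weight(1)[OF a b t0])
    qed auto
    also have "\<dots> = (norm A + norm B) ^ (k + m) * ml_weight a b 1 t k m * M" by simp
    also have "\<dots> \<le> C * (1 / 2) ^ (k + m) * M" using C(2) t M(1) by (intro mult_right_mono) auto
    finally show ?thesis by (simp add: mult_ac)
  qed
  show ?thesis
  proof (rule Lim_null_comparison[OF always_eventually summable_LIMSEQ_zero[OF summable_Suc_times_half_power]])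
    show "\<forall>n. norm (iterated_frac_int A B a b n h t) \<le> C * M * (real (Suc n) * (1 / 2) ^ n)"
      unfolding iterated_frac_int_def using norm_diagonal_sum_le[OF term_le] by blast
  qed
qed

lemma volterra_series:
  fixes A B :: "'b::banach \<Rightarrow>\<^sub>L 'b"
  assumes a: "0 < a" and b: "0 < b" and T: "0 < T"
    and u: "continuous_on {0..T} u" and f: "continuous_on {0..T} f"
    and eq: "\<And>t. t \<in> {0..T} \<Longrightarrow> u t = A (frac_int a u t) + B (frac_int b u t) + f t"
    and t: "t \<in> {0..T}"
  shows "(\<lambda>n. iterated_frac_int A B a b n f t) sums u t"
proof -
  have "(\<Sum>n<N. iterated_frac_int A B a b n f t) = u t - iterated_frac_int A B a b N u t" for N
    using volterra_iterate[OF a b T u f eq t, of N] by (simp add: algebra_simps)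
  moreover have "(\<lambda>N. u t - iterated_frac_int A B a b N u t) \<longlonglongrightarrow> u t - 0"
    by (intro tendsto_diff tendsto_const iterated_frac_int_tendsto_0[OF a b T u t])
  ultimately show ?thesis by (simp add: sums_def)
qed

lemma has_bochner_int_sum:
  assumes "\<And>i. i \<in> S \<Longrightarrow> has_bochner_int M (f i) (I i)"
  shows "has_bochner_int M (\<lambda>w. \<Sum>i\<in>S. f i w) (\<Sum>i\<in>S. I i)"
  using assms
proof (induction S rule: infinite_finite_induct)
  case (insert i S)
  then show ?case by (simp add: has_bochner_int_add)
qed (use has_bochner_int_scaleR_const[of M "\<lambda>_. 0" 0] in simp_all)

text \<open>Every summand is a fractional integral of order \<open>k a + m b + c\<close>. Its kernel is split as
\<open>(t - s) powr (c - 1)\<close>, common to all summands, times a factor that is continuous in \<open>s\<close>.\<close>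

lemma has_bochner_int_mittag_leffler_diagonal:
  fixes A B :: "'b::banach \<Rightarrow>\<^sub>L 'b"
  assumes a: "0 < a" and b: "0 < b" and c: "1 < c" and t: "0 \<le> t" and g: "continuous_on {0..t} g"
  shows "has_bochner_int (lebesgue_on {0..t})
      (\<lambda>s. (t - s) powr (c - 1) *\<^sub>R diagonal_sum (mittag_leffler_term A B a b c (t - s)) n (g s))
      (diagonal_sum (\<lambda>k m. Qop A B k m (frac_int (real k * a + real m * b + c) g t)) n)"
proof -
  have terms: "has_bochner_int (lebesgue_on {0..t})
      (\<lambda>s. (t - s) powr (c - 1) *\<^sub>R mittag_leffler_term A B a b c (t - s) k m (g s))
      (Qop A B k m (frac_int (real k * a + real m * b + c) g t))" for k m
  proof -
    define X where "X = real k * a + real m * b"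
    have "0 \<le> X" using a b by (simp add: X_def)
    then have X: "0 < X + c" "0 < X + c - 1" using c by linarith+
    have L: "bounded_linear (\<lambda>v. (1 / Gamma (X + c)) *\<^sub>R Qop A B k m v)"
      by (intro bounded_linear_scaleR_right bounded_linear_compose[OF bounded_linear_scaleR_right] blinfun.bounded_linear_right)
    have int: "has_bochner_int (lebesgue_on {0..t})
        (\<lambda>s. (1 / Gamma (X + c)) *\<^sub>R Qop A B k m ((t - s) powr (X + c - 1) *\<^sub>R g s))
        ((1 / Gamma (X + c)) *\<^sub>R Qop A B k m (Gamma (X + c) *\<^sub>R frac_int (X + c) g t))"
      by (rule has_bochner_int_bounded_linear[OF has_bochner_int_frac_int[OF X(1) t g] L])
    have val: "(1 / Gamma (X + c)) *\<^sub>R Qop A B k m (Gamma (X + c) *\<^sub>R frac_int (X + c) g t)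
        = Qop A B k m (frac_int (X + c) g t)"
      using Gamma_real_neq_0[OF X(1)] by (simp add: blinfun.scaleR_right)
    have eq: "(1 / Gamma (X + c)) *\<^sub>R Qop A B k m ((t - s) powr (X + c - 1) *\<^sub>R g s)
        = (t - s) powr (c - 1) *\<^sub>R mittag_leffler_term A B a b c (t - s) k m (g s)" if s: "s \<in> {0..t}" for s
    proof -
      \<comment> \<open>the case distinction matters only at \<open>s = t\<close>, where both sides vanish since \<open>0 powr z = 0\<close>\<close>
      have "(t - s) powr (X + c - 1) = (t - s) powr (c - 1) * (if k = 0 \<and> m = 0 then 1 else (t - s) powr X)"
        by (auto simp: X_def powr_add[symmetric] algebra_simps)
      then show ?thesis
        by (simp add: mittag_leffler_term_def X_def[symmetric] blinfun.scaleR_right blinfun.scaleR_left)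
    qed
    show ?thesis
      unfolding X_def[symmetric]
      by (rule has_bochner_int_cong_AE[OF int[unfolded val]], rule AE_I2, rule eq) simp
  qed
  have "has_bochner_int (lebesgue_on {0..t})
      (\<lambda>s. \<Sum>k\<le>n. (t - s) powr (c - 1) *\<^sub>R mittag_leffler_term A B a b c (t - s) k (n - k) (g s))
      (\<Sum>k\<le>n. Qop A B k (n - k) (frac_int (real k * a + real (n - k) * b + c) g t))"
    by (rule has_bochner_int_sum) (rule terms)
  then show ?thesis
    by (simp only: diagonal_sum_def blinfun.sum_left scaleR_sum_right)
qed

text \<open>Summation and integration may be exchanged because the series converges uniformly and the
remaining kernel \<open>(t - s) powr (c - 1)\<close> is integrable.\<close>

lemma mittag_leffler_convolution:
  fixes A B :: "'b::banach \<Rightarrow>\<^sub>L 'b"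
  assumes a: "0 < a" and b: "0 < b" and c: "1 < c" and t: "0 < t" and g: "continuous_on {0..t} g"
  obtains I where "has_bochner_int (lebesgue_on {0..t})
      (\<lambda>s. (t - s) powr (c - 1) *\<^sub>R mittag_leffler A B a b c (t - s) (g s)) I"
    "(\<lambda>n. diagonal_sum (\<lambda>k m. Qop A B k m (frac_int (real k * a + real m * b + c) g t)) n) sums I"
proof -
  let ?M = "lebesgue_on {0..t}" and ?F = "\<lambda>n r. diagonal_sum (mittag_leffler_term A B a b c r) n"
  let ?K = "\<lambda>n. diagonal_sum (\<lambda>k m. Qop A B k m (frac_int (real k * a + real m * b + c) g t)) n"
  have c1: "1 \<le> c" "0 < c" and t0: "0 \<le> t" using c t by auto
  note mls = mittag_leffler_series[OF a b c1(1) t, where A = A and B = B]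
  have "continuous_on {0..t} (\<lambda>s. mittag_leffler A B a b c (t - s))"
    by (rule continuous_on_compose2[OF mls(5)]) (auto intro!: continuous_intros)
  then have "continuous_on {0..t} (\<lambda>s. mittag_leffler A B a b c (t - s) (g s))"
    by (rule bounded_bilinear.continuous_on[OF bounded_bilinear_blinfun_apply _ g])
  then obtain I where I: "has_bochner_int ?M
      (\<lambda>s. (t - s) powr (c - 1) *\<^sub>R mittag_leffler A B a b c (t - s) (g s)) I"
    using bochner_integrable_scaleR_continuous[OF integral_powr(1)[OF c1(2) t0]] by metis
  obtain G where G: "0 \<le> G" "\<forall>s\<in>{0..t}. norm (g s) \<le> G"
    using continuous_on_Icc_bounded[OF g] .
  define D where "D = Gamma c * riesz_kernel c t * G"
  have D: "0 \<le> D" using G c1 by (simp add: D_def riesz_kernel_nonneg Gamma_real_pos less_imp_le)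
  have partials: "has_bochner_int ?M (\<lambda>s. (t - s) powr (c - 1) *\<^sub>R (\<Sum>n<N. ?F n (t - s)) (g s)) (\<Sum>n<N. ?K n)" for N
    using has_bochner_int_sum[of "{..<N}" ?M _ ?K, OF has_bochner_int_mittag_leffler_diagonal[OF a b c t0 g]]
    by (simp add: blinfun.sum_left scaleR_sum_right)
  have "(\<lambda>N. \<Sum>n<N. ?K n) \<longlonglongrightarrow> I"
  proof (rule LIMSEQ_I)
    fix r :: real assume r: "0 < r"
    define e where "e = r / (D + 1)"
    have e: "0 < e" "D * e < r" using r D by (auto simp: e_def field_simps)
    from uniform_limitD[OF mls(3) e(1)]
    obtain N0 where N0: "\<forall>N\<ge>N0. \<forall>s\<in>{0..t}. dist (\<Sum>n<N. ?F n s) (mittag_leffler A B a b c s) < e"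
      by (auto simp: eventually_sequentially)
    have "norm ((\<Sum>n<N. ?K n) - I) \<le> D * e" if N: "N0 \<le> N" for N
    proof -
      have "has_bochner_int ?M (\<lambda>s. (t - s) powr (c - 1) *\<^sub>R (\<Sum>n<N. ?F n (t - s)) (g s)
          + - ((t - s) powr (c - 1) *\<^sub>R mittag_leffler A B a b c (t - s) (g s))) ((\<Sum>n<N. ?K n) + - I)"
        by (intro has_bochner_int_add partials has_bochner_int_bounded_linear[OF I] bounded_linear_minus bounded_linear_ident)
      then have "norm ((\<Sum>n<N. ?K n) + - I) \<le> (\<integral>s. (t - s) powr (c - 1) * (e * G) \<partial>?M)"
      proof (rule has_bochner_int_norm_le)
        show "integrable ?M (\<lambda>s. (t - s) powr (c - 1) * (e * G))"
          using integral_powr(1)[OF c1(2) t0] by simp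
        show "AE s in ?M. norm ((t - s) powr (c - 1) *\<^sub>R (\<Sum>n<N. ?F n (t - s)) (g s)
          + - ((t - s) powr (c - 1) *\<^sub>R mittag_leffler A B a b c (t - s) (g s))) \<le> (t - s) powr (c - 1) * (e * G)"
        proof (rule AE_I2)
          fix s assume "s \<in> space ?M"
          then have s: "s \<in> {0..t}" by simp
          let ?d = "(\<Sum>n<N. ?F n (t - s)) - mittag_leffler A B a b c (t - s)"
          have "norm ?d < e" using N0 N s by (auto simp: dist_norm)
          then have "norm (?d (g s)) \<le> e * G"
            using G s e by (intro order_trans[OF norm_blinfun] mult_mono) auto
          moreover have "(t - s) powr (c - 1) *\<^sub>R (\<Sum>n<N. ?F n (t - s)) (g s)
              + - ((t - s) powr (c - 1) *\<^sub>R mittag_leffler A B a b c (t - s) (g s)) = (t - s) powr (c - 1) *\<^sub>R ?d (g s)"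
            by (simp add: blinfun.diff_left scaleR_diff_right)
          ultimately show "norm ((t - s) powr (c - 1) *\<^sub>R (\<Sum>n<N. ?F n (t - s)) (g s)
              + - ((t - s) powr (c - 1) *\<^sub>R mittag_leffler A B a b c (t - s) (g s))) \<le> (t - s) powr (c - 1) * (e * G)"
            by (simp add: mult_left_mono)
        qed
      qed
      also have "\<dots> = D * e"
        using integral_powr(2)[OF c1(2) t0] by (simp add: D_def)
      finally show ?thesis by simp
    qed
    then show "\<exists>N0. \<forall>N\<ge>N0. norm ((\<Sum>n<N. ?K n) - I) < r"
      using e(2) by (intro exI[of _ N0]) (auto intro: le_less_trans)
  qed
  then show ?thesis using that I by (simp add: sums_def)
qed

lemma double_series_bounded_linear:
  fixes F :: "nat \<Rightarrow> nat \<Rightarrow> 'c::banach"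
  assumes \<Phi>: "bounded_linear \<Phi>" and F: "double_summable F"
  shows "double_summable (\<lambda>k m. \<Phi> (F k m))" and "(\<Sum>k. \<Sum>m. \<Phi> (F k m)) = \<Phi> (\<Sum>k. \<Sum>m. F k m)"
proof -
  have F': "summable (F k)" "summable (\<lambda>k. \<Sum>m. F k m)" for k
    using F by (auto simp: double_summable_def)
  have row: "(\<Sum>m. \<Phi> (F k m)) = \<Phi> (\<Sum>m. F k m)" for k
    by (rule bounded_linear.suminf[OF \<Phi> F'(1), symmetric])
  show "double_summable (\<lambda>k m. \<Phi> (F k m))"
    unfolding double_summable_def row using bounded_linear.summable[OF \<Phi>] F' by auto
  show "(\<Sum>k. \<Sum>m. \<Phi> (F k m)) = \<Phi> (\<Sum>k. \<Sum>m. F k m)"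
    unfolding row by (rule bounded_linear.suminf[OF \<Phi> F'(2), symmetric])
qed

section \<open>From the differential equation to the integral equation\<close>

lemma caputo_eq_frac_int:
  assumes \<nu>: "0 < \<nu>" and t: "0 \<le> t" and eq: "\<And>s. s \<in> {0..t} \<Longrightarrow> nth_deriv_on J (nat \<lceil>\<nu>\<rceil>) x s = h s"
  shows "caputo J \<nu> x t = frac_int (real (nat \<lceil>\<nu>\<rceil>) - \<nu>) h t"
proof -
  let ?n = "nat \<lceil>\<nu>\<rceil>"
  have "caputo J \<nu> x t = frac_int (real ?n - \<nu>) (nth_deriv_on J ?n x) t"
    by (simp add: caputo_def frac_int_def Let_def)
  also have "\<dots> = frac_int (real ?n - \<nu>) h t"
  proof (cases "real ?n - \<nu> = 0")
    case True
    then show ?thesis using eq[of t] t by (simp add: frac_int_def)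
  next
    case False
    then have "0 < real ?n - \<nu>" using real_nat_ceiling_ge[of \<nu>] by linarith
    then show ?thesis using eq by (intro frac_int_cong) auto
  qed
  finally show ?thesis .
qed

text \<open>Apply the fractional integral of order \<open>\<alpha>\<close> to the equation. By the semigroup law, \<open>I\<^sup>\<alpha>\<close> turns the Caputo
derivative of order \<open>\<alpha>\<close>, which is \<open>I\<close> of order \<open>2 - \<alpha>\<close> applied to \<open>x''\<close>, into the double integral of \<open>x''\<close>, that is
into \<open>x t - \<eta> - t \<eta>'\<close>. It turns the one of order \<open>\<beta>\<close>, which is \<open>I\<close> of order \<open>1 - \<beta>\<close> applied to \<open>x'\<close>, into
\<open>I\<close> of order \<open>\<alpha> - \<beta>\<close> applied to \<open>x - \<eta>\<close>.\<close>

lemma cauchy_problem_volterra: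
  fixes A B :: "'b::banach \<Rightarrow>\<^sub>L 'b" and x :: "real \<Rightarrow> 'b"
  assumes T: "0 < T" and \<alpha>: "1 < \<alpha>" "\<alpha> \<le> 2" and \<beta>: "0 < \<beta>" "\<beta> \<le> 1"
    and g: "continuous_on {0..T} g" and x: "C2_on {0..T} x"
    and eq: "\<forall>t\<in>{0<..T}. caputo {0..T} \<alpha> x t - A (caputo {0..T} \<beta> x t) = B (x t) + g t"
    and \<eta>: "x 0 = \<eta>" and \<eta>': "vector_derivative x (at 0 within {0..T}) = \<eta>'"
  shows "continuous_on {0..T} x"
    and "t \<in> {0..T} \<Longrightarrow> x t - \<eta> = A (frac_int (\<alpha> - \<beta>) (\<lambda>s. x s - \<eta>) t) + B (frac_int \<alpha> (\<lambda>s. x s - \<eta>) t)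
      + (riesz_kernel 1 t *\<^sub>R \<eta>' + riesz_kernel \<alpha> t *\<^sub>R B \<eta> + frac_int \<alpha> g t)"
proof -
  let ?J = "{0..T}"
  obtain x' x'' where x': "\<forall>t\<in>?J. (x has_vector_derivative x' t) (at t within ?J)"
    and x'': "\<forall>t\<in>?J. (x' has_vector_derivative x'' t) (at t within ?J)" and c2: "continuous_on ?J x''"
    using x unfolding C2_on_def by blast
  have vd: "vector_derivative f (at t within ?J) = d"
    if "(f has_vector_derivative d) (at t within ?J)" "t \<in> ?J" for f :: "real \<Rightarrow> 'b" and d t
    using vector_derivative_within_cbox[of 0 T t f d] that T by simp
  have c0: "continuous_on ?J x" and c1: "continuous_on ?J x'"
    using x' x'' by (auto simp: continuous_on_eq_continuous_within intro: has_vector_derivative_continuous)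
  then show "continuous_on ?J x" by simp
  have d1: "nth_deriv_on ?J 1 x s = x' s" if "s \<in> ?J" for s
    using vd x' that by simp
  have d2: "nth_deriv_on ?J 2 x s = x'' s" if "s \<in> ?J" for s
  proof -
    have "((\<lambda>t. vector_derivative x (at t within ?J)) has_vector_derivative x'' s) (at s within ?J)"
      by (rule has_vector_derivative_transform[OF that _ x''[rule_format, OF that]]) (use vd x' in auto)
    from vd[OF this that] show ?thesis by (simp add: numeral_2_eq_2)
  qed
  have n: "nat \<lceil>\<alpha>\<rceil> = 2" "nat \<lceil>\<beta>\<rceil> = 1"
  proof -
    have "\<lceil>\<alpha>\<rceil> = 2" using \<alpha> by (intro ceiling_unique) auto
    moreover have "\<lceil>\<beta>\<rceil> = 1" using \<beta> by (intro ceiling_unique) auto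
    ultimately show "nat \<lceil>\<alpha>\<rceil> = 2" "nat \<lceil>\<beta>\<rceil> = 1" by simp_all
  qed
  define D2 where "D2 = frac_int (2 - \<alpha>) x''"
  define D1 where "D1 = frac_int (1 - \<beta>) x'"
  have eq': "D2 s = A (D1 s) + (B (x s) + g s)" if "s \<in> {0<..T}" for s
  proof -
    have "caputo ?J \<alpha> x s = D2 s"
      using caputo_eq_frac_int[of \<alpha> s ?J x x''] \<alpha> n d2 that by (simp add: D2_def)
    moreover have "caputo ?J \<beta> x s = D1 s"
      using caputo_eq_frac_int[of \<beta> s ?J x x'] \<beta> n d1 that by (simp add: D1_def)
    ultimately show ?thesis using eq that by (auto simp: algebra_simps)
  qed
  assume t: "t \<in> ?J"
  then have t0: "0 \<le> t" and sub: "{0..t} \<subseteq> ?J" by auto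
  have \<alpha>0: "0 < \<alpha>" "0 \<le> \<alpha>" and exps: "0 \<le> 2 - \<alpha>" "0 \<le> 1 - \<beta>" "0 < \<alpha> - \<beta>" "0 \<le> \<alpha> - \<beta>"
    using \<alpha> \<beta> by auto
  have cD1: "continuous_on {0..t} D1"
    unfolding D1_def by (rule continuous_on_subset[OF continuous_on_frac_int[OF exps(2) T c1] sub])
  have cx: "continuous_on {0..t} x" and cg: "continuous_on {0..t} g"
    by (rule continuous_on_subset[OF c0 sub], rule continuous_on_subset[OF g sub])
  have const: "frac_int c (\<lambda>s. v) r = riesz_kernel c r *\<^sub>R v" if "0 \<le> c" "0 \<le> r" for c r and v :: 'b
    using frac_int_riesz_kernel[of c 0 r v] that by (simp add: riesz_kernel_def[of 0])
  have int1: "frac_int 1 x' s = x s - \<eta>" "frac_int 1 x'' s = x' s - \<eta>'" if "s \<in> ?J" for s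
    using frac_int_1_deriv[OF T _ c1 that] frac_int_1_deriv[OF T _ c2 that] x' x'' \<eta> \<eta>' vd[of x "x' 0" 0] T by auto
  have "frac_int \<alpha> D2 t = frac_int (1 + 1) x'' t"
    unfolding D2_def using frac_int_frac_int[OF \<alpha>0(2) exps(1) T c2 t] by simp
  also have "\<dots> = frac_int 1 (frac_int 1 x'') t"
    by (rule frac_int_frac_int[OF zero_le_one zero_le_one T c2 t, symmetric])
  also have "\<dots> = frac_int 1 (\<lambda>s. x' s - \<eta>') t"
    using int1(2) t by (intro frac_int_cong) auto
  also have "\<dots> = (x t - \<eta>) - riesz_kernel 1 t *\<^sub>R \<eta>'"
    using frac_int_diff[OF zero_le_one t0 continuous_on_subset[OF c1 sub] continuous_on_const] int1(1)[OF t]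
    by (simp add: const t0)
  finally have lhs: "frac_int \<alpha> D2 t = (x t - \<eta>) - riesz_kernel 1 t *\<^sub>R \<eta>'" .
  have "frac_int \<alpha> D1 t = frac_int ((\<alpha> - \<beta>) + 1) x' t"
    unfolding D1_def using frac_int_frac_int[OF \<alpha>0(2) exps(2) T c1 t] by (simp add: algebra_simps)
  also have "\<dots> = frac_int (\<alpha> - \<beta>) (frac_int 1 x') t"
    by (rule frac_int_frac_int[OF exps(4) zero_le_one T c1 t, symmetric])
  also have "\<dots> = frac_int (\<alpha> - \<beta>) (\<lambda>s. x s - \<eta>) t"
    using int1(1) t by (intro frac_int_cong exps) auto
  finally have D1: "frac_int \<alpha> D1 t = frac_int (\<alpha> - \<beta>) (\<lambda>s. x s - \<eta>) t" .
  have Ix: "frac_int \<alpha> x t = frac_int \<alpha> (\<lambda>s. x s - \<eta>) t + riesz_kernel \<alpha> t *\<^sub>R \<eta>"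
    using frac_int_diff[OF \<alpha>0(2) t0 cx continuous_on_const, of \<eta>] const[OF \<alpha>0(2) t0, of \<eta>] by simp
  have "frac_int \<alpha> D2 t = frac_int \<alpha> (\<lambda>s. A (D1 s) + (B (x s) + g s)) t"
    using eq' t by (intro frac_int_cong \<alpha>0) auto
  also have "\<dots> = frac_int \<alpha> (\<lambda>s. A (D1 s)) t + (frac_int \<alpha> (\<lambda>s. B (x s)) t + frac_int \<alpha> g t)"
    by (simp only: frac_int_add[OF \<alpha>0(2) t0] continuous_on_add continuous_on_blinfun_apply cD1 cx cg)
  also have "\<dots> = A (frac_int \<alpha> D1 t) + (B (frac_int \<alpha> x t) + frac_int \<alpha> g t)"
    by (simp only: frac_int_bounded_linear[OF blinfun.bounded_linear_right \<alpha>0(2) t0] cD1 cx)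
  finally have "(x t - \<eta>) - riesz_kernel 1 t *\<^sub>R \<eta>'
      = A (frac_int (\<alpha> - \<beta>) (\<lambda>s. x s - \<eta>) t)
      + (B (frac_int \<alpha> (\<lambda>s. x s - \<eta>) t) + riesz_kernel \<alpha> t *\<^sub>R B \<eta> + frac_int \<alpha> g t)"
    unfolding lhs D1 Ix by (simp add: blinfun.add_right blinfun.scaleR_right)
  then show "x t - \<eta> = A (frac_int (\<alpha> - \<beta>) (\<lambda>s. x s - \<eta>) t) + B (frac_int \<alpha> (\<lambda>s. x s - \<eta>) t)
      + (riesz_kernel 1 t *\<^sub>R \<eta>' + riesz_kernel \<alpha> t *\<^sub>R B \<eta> + frac_int \<alpha> g t)"
    by (simp add: algebra_simps)
qed

lemma diagonal_sum_add: "diagonal_sum (\<lambda>k m. F k m + G k m) n = diagonal_sum F n + diagonal_sum G n"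
  by (simp add: diagonal_sum_def sum.distrib)

text \<open>The inhomogeneity consists of two Riesz kernels and a fractional integral of \<open>g\<close>. The fractional
integrals of all three are explicit, and they turn the three parts of the iterated series into the two
Mittag-Leffler functions and the convolution.\<close>

lemma volterra_solution_formula:
  fixes A B :: "'b::banach \<Rightarrow>\<^sub>L 'b"
  assumes a: "0 < a" and b: "1 < b" and T: "0 < T"
    and u: "continuous_on {0..T} u" and g: "continuous_on {0..T} g"
    and eq: "\<And>t. t \<in> {0..T} \<Longrightarrow> u t = A (frac_int a u t) + B (frac_int b u t)
      + (riesz_kernel 1 t *\<^sub>R v + riesz_kernel b t *\<^sub>R w + frac_int b g t)"
    and t: "t \<in> {0<..T}"
  shows "\<exists>I. has_bochner_int (lebesgue_on {0..t})
          (\<lambda>s. (t - s) powr (b - 1) *\<^sub>R mittag_leffler A B a b b (t - s) (g s)) I \<and>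
      u t = t *\<^sub>R mittag_leffler A B a b 2 t v + t powr b *\<^sub>R mittag_leffler A B a b (b + 1) t w + I"
proof -
  have b0: "0 < b" "0 \<le> b" "1 \<le> b" "1 \<le> b + 1" using b by auto
  have t0: "0 \<le> t" and tpos: "0 < t" and tT: "t \<in> {0..T}" and sub: "{0..t} \<subseteq> {0..T}" using t by auto
  have cg: "continuous_on {0..t} g" by (rule continuous_on_subset[OF g sub])
  define f where "f = (\<lambda>t. riesz_kernel 1 t *\<^sub>R v + riesz_kernel b t *\<^sub>R w + frac_int b g t)"
  have f: "continuous_on {0..T} f"
    unfolding f_def by (intro continuous_intros continuous_on_riesz_kernel continuous_on_frac_int b0 T g) simp
  obtain I where I: "has_bochner_int (lebesgue_on {0..t})
      (\<lambda>s. (t - s) powr (b - 1) *\<^sub>R mittag_leffler A B a b b (t - s) (g s)) I"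
    and K: "(\<lambda>n. diagonal_sum (\<lambda>k m. Qop A B k m (frac_int (real k * a + real m * b + b) g t)) n) sums I"
    by (rule mittag_leffler_convolution[OF a b0(1) b tpos cg])
  have terms: "Qop A B k m (frac_int (real k * a + real m * b) f t)
      = t *\<^sub>R mittag_leffler_term A B a b 2 t k m v + t powr b *\<^sub>R mittag_leffler_term A B a b (b + 1) t k m w
        + Qop A B k m (frac_int (real k * a + real m * b + b) g t)" for k m
  proof -
    define X where "X = real k * a + real m * b"
    have X: "0 \<le> X" using a b0 by (simp add: X_def)
    have cr: "continuous_on {0..t} (\<lambda>s. riesz_kernel c s *\<^sub>R z)" if "0 \<le> c" for c and z :: 'b
      by (intro continuous_intros continuous_on_riesz_kernel that)
    have cI: "continuous_on {0..t} (frac_int b g)"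
      by (rule continuous_on_subset[OF continuous_on_frac_int[OF b0(2) T g] sub])
    have "frac_int X f t = frac_int X (\<lambda>s. riesz_kernel 1 s *\<^sub>R v) t + frac_int X (\<lambda>s. riesz_kernel b s *\<^sub>R w) t
        + frac_int X (frac_int b g) t"
      unfolding f_def by (simp only: frac_int_add[OF X t0] continuous_on_add cr cI zero_le_one b0(2))
    also have "\<dots> = riesz_kernel (X + 1) t *\<^sub>R v + riesz_kernel (X + b) t *\<^sub>R w + frac_int (X + b) g t"
      using frac_int_frac_int[OF X b0(2) T g tT] by (simp add: frac_int_riesz_kernel X t0 b0(2) add.commute)
    also have "riesz_kernel (X + 1) t = t * ml_weight a b 2 t k m"
      using riesz_kernel_eq_ml_weight(2)[OF a b0(1) t0, of 1 k m] tpos by (simp add: X_def)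
    also have "riesz_kernel (X + b) t = t powr b * ml_weight a b (b + 1) t k m"
      unfolding X_def by (rule riesz_kernel_eq_ml_weight(2)[OF a b0(1) t0 b0(1)])
    finally show ?thesis
      by (simp add: X_def[symmetric] blinfun.add_right blinfun.scaleR_right blinfun.scaleR_left
          mittag_leffler_term_def ml_weight_def)
  qed
  have "iterated_frac_int A B a b n f t
      = t *\<^sub>R diagonal_sum (mittag_leffler_term A B a b 2 t) n v
      + t powr b *\<^sub>R diagonal_sum (mittag_leffler_term A B a b (b + 1) t) n w
      + diagonal_sum (\<lambda>k m. Qop A B k m (frac_int (real k * a + real m * b + b) g t)) n" for n
    unfolding iterated_frac_int_def terms diagonal_sum_add
    by (simp add: diagonal_sum_def blinfun.sum_left scaleR_sum_right)
  moreover have "(\<lambda>n. t *\<^sub>R diagonal_sum (mittag_leffler_term A B a b 2 t) n v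
      + t powr b *\<^sub>R diagonal_sum (mittag_leffler_term A B a b (b + 1) t) n w
      + diagonal_sum (\<lambda>k m. Qop A B k m (frac_int (real k * a + real m * b + b) g t)) n)
      sums (t *\<^sub>R mittag_leffler A B a b 2 t v + t powr b *\<^sub>R mittag_leffler A B a b (b + 1) t w + I)"
    by (intro sums_add K bounded_linear.sums[OF bounded_linear_scaleR_right]
        bounded_linear.sums[OF blinfun.bounded_linear_left]
        mittag_leffler_series(2)[OF a b0(1) _ T tT] b0) simp
  ultimately have "(\<lambda>n. iterated_frac_int A B a b n f t)
      sums (t *\<^sub>R mittag_leffler A B a b 2 t v + t powr b *\<^sub>R mittag_leffler A B a b (b + 1) t w + I)"
    by simp
  moreover have "(\<lambda>n. iterated_frac_int A B a b n f t) sums u t"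
    by (rule volterra_series[OF a b0(1) T u f _ tT]) (use eq in \<open>simp add: f_def\<close>)
  ultimately show ?thesis using I sums_unique2 by blast
qed

section \<open>Boundedness of the transformed operators\<close>

text \<open>By Baire's theorem the closure of some \<open>{x. norm (L x) \<le> n}\<close> contains a ball. By convexity and
symmetry the ball may be centred at \<open>0\<close>, and by homogeneity every \<open>x\<close> in the ball of radius \<open>r s\<close> is
approximated up to \<open>r s / 2\<close> by some \<open>y\<close> with \<open>norm (L y) \<le> n s\<close>. Repeating this with \<open>s = 1, 1/2, 1/4, \<dots>\<close>
expands \<open>x\<close> into a series whose image under \<open>L\<close> converges absolutely, to \<open>L x\<close> because the graph is
closed.\<close>

theorem closed_graph_imp_bounded_linear:
  fixes L :: "'a::banach \<Rightarrow> 'b::banach"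
  assumes L: "linear L"
    and closed: "\<And>v x y. v \<longlonglongrightarrow> x \<Longrightarrow> (\<lambda>n. L (v n)) \<longlonglongrightarrow> y \<Longrightarrow> L x = y"
  shows "bounded_linear L"
proof -
  interpret linear L by fact
  define V where "V n = closure {x. norm (L x) \<le> real n}" for n :: nat
  have "\<exists>n. interior (V n) \<noteq> {}"
  proof (rule ccontr)
    assume "\<not> (\<exists>n. interior (V n) \<noteq> {})"
    then have "interior (V n) = {}" for n by blast
    then have "closedin euclidean S \<and> euclidean interior_of S = {}" if "S \<in> range V" for S
      using that by (auto simp: V_def)
    then have "euclidean interior_of \<Union> (range V) = {}"
      by (intro Met_TC.metric_Baire_category_alt[unfolded mtopology_is_euclidean]) (simp_all add: complete_UNIV)
    moreover have "\<Union> (range V) = UNIV"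
    proof -
      have "x \<in> V (nat \<lceil>norm (L x)\<rceil>)" for x
        unfolding V_def by (rule subsetD[OF closure_subset]) (simp add: real_nat_ceiling_ge)
      then show ?thesis by blast
    qed
    ultimately show False by simp
  qed
  then obtain n c r where r: "0 < r" "ball c r \<subseteq> V n"
    by (meson ex_in_conv mem_interior)
  have ball: "\<exists>y. norm (L y) \<le> real n \<and> norm (x - y) < e" if x: "norm x < r" and e: "0 < e" for x e
  proof -
    have close: "\<exists>y. norm (L y) \<le> real n \<and> norm (z - y) < e" if "z \<in> V n" for z
      using that e unfolding V_def closure_approachable by (auto simp: dist_norm norm_minus_commute)
    have "c + x \<in> V n" "c - x \<in> V n"
      using x by (auto intro!: subsetD[OF r(2)] simp: dist_norm)
    from close[OF this(1)] close[OF this(2)] obtain y z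
      where y: "norm (L y) \<le> real n" "norm ((c + x) - y) < e"
        and z: "norm (L z) \<le> real n" "norm ((c - x) - z) < e" by blast
    have "x - (1/2) *\<^sub>R (y - z) = (1/2) *\<^sub>R (((c + x) - y) - ((c - x) - z))"
      by (simp add: algebra_simps flip: scaleR_add_left)
    then have "norm (x - (1/2) *\<^sub>R (y - z)) \<le> (1/2) * (norm ((c + x) - y) + norm ((c - x) - z))"
      using norm_triangle_ineq4[of "(c + x) - y" "(c - x) - z"] by simp
    also have "\<dots> < e" using y z by simp
    finally have "norm (x - (1/2) *\<^sub>R (y - z)) < e" .
    moreover have "norm (L ((1/2) *\<^sub>R (y - z))) \<le> real n"
      using norm_triangle_ineq4[of "L y" "L z"] y(1) z(1) by (simp add: scale diff)
    ultimately show ?thesis by blast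
  qed
  have scaled: "\<exists>y. norm (L y) \<le> real n * s \<and> norm (x - y) < r * (s / 2)"
    if s: "0 < s" and x: "norm x < r * s" for x and s :: real
  proof -
    have "norm ((1 / s) *\<^sub>R x) < r" using s x by (simp add: field_simps)
    then obtain y where y: "norm (L y) \<le> real n" "norm ((1 / s) *\<^sub>R x - y) < r / 2"
      using ball[of "(1 / s) *\<^sub>R x" "r / 2"] r(1) by auto
    have "x - s *\<^sub>R y = s *\<^sub>R ((1 / s) *\<^sub>R x - y)" using s by (simp add: scaleR_diff_right)
    then have "norm (x - s *\<^sub>R y) = s * norm ((1 / s) *\<^sub>R x - y)" using s by simp
    also have "\<dots> < s * (r / 2)" using y(2) s by (rule mult_strict_left_mono)
    finally have "norm (x - s *\<^sub>R y) < r * (s / 2)" by (simp add: mult.commute)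
    moreover have "norm (L (s *\<^sub>R y)) \<le> real n * s" using y(1) s by (simp add: scale mult.commute mult_left_mono)
    ultimately show ?thesis by blast
  qed
  have bound: "norm (L x) \<le> 2 * real n" if x: "norm x < r" for x
  proof -
    \<comment> \<open>\<open>Y s w\<close> is the approximation of \<open>w\<close> at scale \<open>s\<close>, and \<open>w k\<close> is what remains of \<open>x\<close> after \<open>k\<close> steps\<close>
    define Y where "Y s w = (SOME y. norm (L y) \<le> real n * s \<and> norm (w - y) < r * (s / 2))" for s :: real and w
    define w where "w = rec_nat x (\<lambda>k u. u - Y ((1/2) ^ k) u)"
    have w: "w 0 = x" "w (Suc k) = w k - Y ((1/2) ^ k) (w k)" for k
      by (simp_all add: w_def)
    have Y: "norm (L (Y s u)) \<le> real n * s \<and> norm (u - Y s u) < r * (s / 2)" if "0 < s" "norm u < r * s" for s u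
      unfolding Y_def by (rule someI_ex[OF scaled[OF that]])
    have wr: "norm (w k) < r * (1/2) ^ k" for k
    proof (induction k)
      case (Suc k)
      then show ?case using Y[of "(1/2) ^ k" "w k"] by (simp add: w)
    qed (use x in \<open>simp add: w\<close>)
    have LY: "norm (L (w k - w (Suc k))) \<le> real n * (1/2) ^ k" for k
      using Y[OF _ wr[of k]] by (simp add: w)
    have w0: "w \<longlonglongrightarrow> 0"
    proof (rule Lim_null_comparison[OF always_eventually])
      show "(\<lambda>k. r * (1/2) ^ k) \<longlonglongrightarrow> 0"
        by (intro tendsto_mult_right_zero LIMSEQ_power_zero) simp
    qed (use wr in \<open>auto intro: less_imp_le\<close>)
    have geo: "(\<lambda>k. real n * (1/2) ^ k) sums (real n * 2)"
      using geometric_sums[of "1 / 2 :: real"] by (intro sums_mult) simp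
    have summ: "summable (\<lambda>k. norm (L (w k - w (Suc k))))"
      by (rule summable_comparison_test[OF _ sums_summable[OF geo]]) (use LY in auto)
    have tele: "(\<Sum>k<N. L (w k - w (Suc k))) = L (x - w N)" for N
      by (induction N) (simp_all add: w(1) diff add)
    have "(\<lambda>N. L (x - w N)) \<longlonglongrightarrow> (\<Sum>k. L (w k - w (Suc k)))"
      using summable_LIMSEQ[OF summable_norm_cancel[OF summ]] by (simp add: tele)
    moreover have "(\<lambda>N. x - w N) \<longlonglongrightarrow> x - 0"
      by (intro tendsto_diff tendsto_const w0)
    ultimately have "L x = (\<Sum>k. L (w k - w (Suc k)))"
      using closed by simp
    also have "norm \<dots> \<le> (\<Sum>k. norm (L (w k - w (Suc k))))"
      by (rule summable_norm[OF summ])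
    also have "\<dots> \<le> (\<Sum>k. real n * (1/2) ^ k)"
      by (rule suminf_le[OF LY summ sums_summable[OF geo]])
    also have "\<dots> = 2 * real n" using geo by (simp add: sums_iff)
    finally show ?thesis .
  qed
  show ?thesis
  proof (intro bounded_linear_intro[of L "4 * real n / r"] add scale)
    fix x
    show "norm (L x) \<le> norm x * (4 * real n / r)"
    proof (cases "x = 0")
      case False
      define s where "s = r / (2 * norm x)"
      have s: "0 < s" using False r(1) by (simp add: s_def)
      have "norm (s *\<^sub>R x) < r" using False r(1) by (simp add: s_def)
      from bound[OF this] have "s * norm (L x) \<le> 2 * real n" using s by (simp add: scale)
      then show ?thesis using False r(1) by (simp add: s_def field_simps)
    qed simp
  qed
qed

lemma compact_op_imp_bounded_linear:
  assumes "compact_op f"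
  shows "bounded_linear f"
proof -
  interpret linear f using assms by (simp add: compact_op_def)
  have "compact (closure (f ` cball 0 1))"
    using assms by (simp add: compact_op_def)
  then have "bounded (f ` cball 0 1)"
    by (meson bounded_subset closure_subset compact_imp_bounded)
  then obtain K where K: "\<forall>v\<in>cball 0 1. norm (f v) \<le> K"
    unfolding bounded_iff by blast
  show ?thesis
  proof (rule bounded_linear_intro[of f K, OF add scale])
    fix v
    show "norm (f v) \<le> norm v * K"
    proof (cases "v = 0")
      case False
      have "norm (f ((1 / norm v) *\<^sub>R v)) \<le> K" using K False by simp
      then show ?thesis using False by (simp add: scale field_simps)
    qed (simp add: zero)
  qed
qed

lemma linear_op_on_compose_linear:
  assumes "linear_op_on D F" and "linear r" and "range r \<subseteq> D"
  shows "linear (\<lambda>v. F (r v))"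
proof -
  have r: "r v \<in> D" for v using assms(3) by blast
  show ?thesis
    using assms(1) r by (intro linearI) (auto simp: linear_op_on_def linear_add[OF assms(2)] linear_scale[OF assms(2)])
qed

text \<open>An everywhere defined product of a closed operator with a bounded one has a closed graph.\<close>

lemma closed_op_on_compose_bounded_linear:
  fixes F :: "'a::banach \<Rightarrow> 'b::banach" and r :: "'c::banach \<Rightarrow> 'a"
  assumes F: "linear_op_on D F" "closed_op_on D F" and r: "bounded_linear r" "range r \<subseteq> D"
  shows "bounded_linear (\<lambda>v. F (r v))"
proof (rule closed_graph_imp_bounded_linear)
  show "linear (\<lambda>v. F (r v))"
    by (rule linear_op_on_compose_linear[OF F(1) bounded_linear.linear[OF r(1)] r(2)])
  fix v x y assume v: "v \<longlonglongrightarrow> x" and y: "(\<lambda>n. F (r (v n))) \<longlonglongrightarrow> y"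
  have "(r x, y) \<in> (\<lambda>x. (x, F x)) ` D"
  proof (rule closed_sequentially[OF F(2)[unfolded closed_op_on_def]])
    show "(r (v n), F (r (v n))) \<in> (\<lambda>x. (x, F x)) ` D" for n
      using r(2) by blast
    show "(\<lambda>n. (r (v n), F (r (v n)))) \<longlonglongrightarrow> (r x, y)"
      by (intro tendsto_Pair bounded_linear.tendsto[OF r(1)] v y)
  qed
  then show "F (r x) = y" by auto
qed

lemma bounded_op_on_compose_bounded_linear:
  assumes F: "linear_op_on D F" "bounded_op_on D F" and r: "bounded_linear r" "range r \<subseteq> D"
  shows "bounded_linear (\<lambda>v. F (r v))"
proof -
  interpret linear "\<lambda>v. F (r v)"
    by (rule linear_op_on_compose_linear[OF F(1) bounded_linear.linear[OF r(1)] r(2)])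
  obtain K where K: "\<And>x. x \<in> D \<Longrightarrow> norm (F x) \<le> K * norm x"
    using F(2) by (auto simp: bounded_op_on_def)
  obtain C where C: "\<And>v. norm (r v) \<le> norm v * C"
    using bounded_linear.bounded[OF r(1)] by blast
  show ?thesis
  proof (rule bounded_linear_intro[OF add scale])
    fix v
    have "norm (F (r v)) \<le> K * norm (r v)" using K r(2) by blast
    also have "\<dots> \<le> \<bar>K\<bar> * (norm v * C)"
      by (intro mult_mono C) auto
    finally show "norm (F (r v)) \<le> norm v * (\<bar>K\<bar> * C)" by (simp add: mult_ac)
  qed
qed

section \<open>The representation of mild solutions\<close>

lemma powr_div_Gamma_eq_ml_weight:
  "t powr (real k * a + real m * b + d) / Gamma (real k * a + real m * b + c) = t powr d * ml_weight a b c t k m"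
  by (simp add: ml_weight_def powr_add)

theorem theorem3p6:
  fixes E A0 B0 :: "'a::banach \<Rightarrow> 'b::banach"
    and DE DA DB :: "'a set"
    and Einv :: "'b \<Rightarrow>\<^sub>L 'a"
    and A B :: "'b \<Rightarrow>\<^sub>L 'b"
    and T \<alpha> \<beta> :: real
    and \<eta> \<eta>' :: 'b
    and g :: "real \<Rightarrow> 'b"
    and y :: "real \<Rightarrow> 'a"
  assumes "linear_op_on DE E" and "linear_op_on DA A0" and "linear_op_on DB B0"
    and "closed_op_on DA A0"
    and "bounded_op_on DB B0"
    and "DE \<subseteq> DA" and "DE \<subseteq> DB"
    and "bij_betw E DE UNIV"
    and "compact_op (inv_into DE E)"
    and Einv: "Einv = Blinfun (inv_into DE E)"
    and A: "A = Blinfun (\<lambda>v. A0 (inv_into DE E v))"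
    and B: "B = Blinfun (\<lambda>v. B0 (inv_into DE E v))"
    and "(A o\<^sub>L B) - (B o\<^sub>L A) \<noteq> 0"
    and "0 < T"
    and "1 < \<alpha>" and "\<alpha> \<le> 2" and "0 < \<beta>" and "\<beta> \<le> 1"
    and "continuous_on {0..T} g"
    and "mild_solution T \<alpha> \<beta> Einv A B g \<eta> \<eta>' y"
    and "C2_on {0..T} y"
  shows
    \<comment> \<open>the operators \<open>Einv\<close>, \<open>A\<close> and \<open>B\<close> are well defined\<close>
    "bounded_linear (inv_into DE E) \<and>
     bounded_linear (\<lambda>v. A0 (inv_into DE E v)) \<and>
     bounded_linear (\<lambda>v. B0 (inv_into DE E v)) \<and>
     (let
       S1 = (\<lambda>t k m. (t powr (real k * (\<alpha> - \<beta>) + real m * \<alpha> + \<alpha>)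
                / Gamma (real k * (\<alpha> - \<beta>) + real m * \<alpha> + \<alpha> + 1)) *\<^sub>R (Einv o\<^sub>L Qop A B k m o\<^sub>L B));
       S2 = (\<lambda>t k m. (t powr (real k * (\<alpha> - \<beta>) + real m * \<alpha> + 1)
                / Gamma (real k * (\<alpha> - \<beta>) + real m * \<alpha> + 2)) *\<^sub>R (Einv o\<^sub>L Qop A B k m));
       S3 = (\<lambda>t k m. (t powr (real k * (\<alpha> - \<beta>) + real m * \<alpha> + \<alpha> - 1)
                / Gamma (real k * (\<alpha> - \<beta>) + real m * \<alpha> + \<alpha>)) *\<^sub>R (Einv o\<^sub>L Qop A B k m));
       F3 = (\<lambda>t s. blinfun_apply (\<Sum>k. \<Sum>m. S3 (t - s) k m) (g s));
       G3 = (\<lambda>t s. ((t - s) powr (\<alpha> - 1)) *\<^sub>R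
                blinfun_apply (Einv o\<^sub>L mittag_leffler A B (\<alpha> - \<beta>) \<alpha> \<alpha> (t - s)) (g s))
     in
       \<comment> \<open>all double series converge in operator norm\<close>
       (\<forall>t\<in>{0..T}. double_summable (S1 t) \<and> double_summable (S2 t) \<and> double_summable (S3 t) \<and>
          (\<forall>c\<in>{\<alpha> + 1, 2, \<alpha>}. double_summable (mittag_leffler_term A B (\<alpha> - \<beta>) \<alpha> c t))) \<and>
       (\<forall>t\<in>{0<..T}.
          bochner_integrable (lebesgue_on {0..t}) (F3 t) \<and>
          bochner_integrable (lebesgue_on {0..t}) (G3 t) \<and>
          y t = blinfun_apply (Einv + (\<Sum>k. \<Sum>m. S1 t k m)) \<eta>
                + blinfun_apply (\<Sum>k. \<Sum>m. S2 t k m) \<eta>'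
                + bochner_int (lebesgue_on {0..t}) (F3 t) \<and>
          y t = blinfun_apply
                  (Einv + (t powr \<alpha>) *\<^sub>R (Einv o\<^sub>L mittag_leffler A B (\<alpha> - \<beta>) \<alpha> (\<alpha> + 1) t o\<^sub>L B)) \<eta>
                + t *\<^sub>R blinfun_apply (Einv o\<^sub>L mittag_leffler A B (\<alpha> - \<beta>) \<alpha> 2 t) \<eta>'
                + bochner_int (lebesgue_on {0..t}) (G3 t)))"
proof -
  note T = \<open>0 < T\<close> and \<alpha> = \<open>1 < \<alpha>\<close> \<open>\<alpha> \<le> 2\<close> and \<beta> = \<open>0 < \<beta>\<close> \<open>\<beta> \<le> 1\<close>
    and g = \<open>continuous_on {0..T} g\<close>
  have a: "0 < \<alpha> - \<beta>" and b: "0 < \<alpha>" using \<alpha> \<beta> by auto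
  have "range (inv_into DE E) \<subseteq> DE"
    using bij_betw_inv_into[OF \<open>bij_betw E DE UNIV\<close>] by (simp add: bij_betw_def)
  then have ranges: "range (inv_into DE E) \<subseteq> DA" "range (inv_into DE E) \<subseteq> DB"
    using \<open>DE \<subseteq> DA\<close> \<open>DE \<subseteq> DB\<close> by blast+
  have bounded_Einv: "bounded_linear (inv_into DE E)"
    by (rule compact_op_imp_bounded_linear) fact
  have bounded_A: "bounded_linear (\<lambda>v. A0 (inv_into DE E v))"
    by (rule closed_op_on_compose_bounded_linear[OF _ _ bounded_Einv ranges(1)]) fact+
  have bounded_B: "bounded_linear (\<lambda>v. B0 (inv_into DE E v))"
    by (rule bounded_op_on_compose_bounded_linear[OF _ _ bounded_Einv ranges(2)]) fact+
  define W where "W = mittag_leffler_term A B (\<alpha> - \<beta>) \<alpha>"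
  define W' where "W' = mittag_leffler A B (\<alpha> - \<beta>) \<alpha>"
  define S1 where "S1 = (\<lambda>t k m. (t powr (real k * (\<alpha> - \<beta>) + real m * \<alpha> + \<alpha>)
                / Gamma (real k * (\<alpha> - \<beta>) + real m * \<alpha> + \<alpha> + 1)) *\<^sub>R (Einv o\<^sub>L Qop A B k m o\<^sub>L B))"
  define S2 where "S2 = (\<lambda>t k m. (t powr (real k * (\<alpha> - \<beta>) + real m * \<alpha> + 1)
                / Gamma (real k * (\<alpha> - \<beta>) + real m * \<alpha> + 2)) *\<^sub>R (Einv o\<^sub>L Qop A B k m))"
  define S3 where "S3 = (\<lambda>t k m. (t powr (real k * (\<alpha> - \<beta>) + real m * \<alpha> + \<alpha> - 1)
                / Gamma (real k * (\<alpha> - \<beta>) + real m * \<alpha> + \<alpha>)) *\<^sub>R (Einv o\<^sub>L Qop A B k m))"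
  define F3 where "F3 = (\<lambda>t s. blinfun_apply (\<Sum>k. \<Sum>m. S3 (t - s) k m) (g s))"
  define G3 where "G3 = (\<lambda>t s. ((t - s) powr (\<alpha> - 1)) *\<^sub>R blinfun_apply (Einv o\<^sub>L W' \<alpha> (t - s)) (g s))"
  have mls: "double_summable (W c t)" "(\<Sum>k. \<Sum>m. W c t k m) = W' c t"
    if "t \<in> {0..T}" "c \<in> {\<alpha> + 1, 2, \<alpha>}" for c t
    using mittag_leffler_series(1)[OF a b _ T that(1), of c A B] that(2) \<alpha>
    by (auto simp: W_def W'_def mittag_leffler_def)
  have S_eq: "S1 t k m = t powr \<alpha> *\<^sub>R (Einv o\<^sub>L W (\<alpha> + 1) t k m o\<^sub>L B)"
    "S2 t k m = t powr 1 *\<^sub>R (Einv o\<^sub>L W 2 t k m)"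
    "S3 t k m = t powr (\<alpha> - 1) *\<^sub>R (Einv o\<^sub>L W \<alpha> t k m)" for t k m
    unfolding S1_def S2_def S3_def add.assoc[of "_ + _"] add_diff_eq[symmetric, of "_ + _"]
      powr_div_Gamma_eq_ml_weight W_def mittag_leffler_term_def ml_weight_def[symmetric]
    by (rule blinfun_eqI, simp add: blinfun.scaleR_left blinfun.scaleR_right)+
  \<comment> \<open>the operators in front of the series act term by term because they are continuous in the operator norm\<close>
  have \<Phi>: "bounded_linear (\<lambda>Q. c *\<^sub>R (Einv o\<^sub>L Q))" "bounded_linear (\<lambda>Q. c *\<^sub>R (Einv o\<^sub>L Q o\<^sub>L B))" for c
  proof -
    note compose = bounded_bilinear_blinfun_compose
    have 1: "bounded_linear (\<lambda>Q. Einv o\<^sub>L Q)"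
      by (rule bounded_bilinear.bounded_linear_right[OF compose])
    have 2: "bounded_linear (\<lambda>Q. Einv o\<^sub>L Q o\<^sub>L B)"
      by (rule bounded_linear_compose[OF bounded_bilinear.bounded_linear_left[OF compose] 1])
    show "bounded_linear (\<lambda>Q. c *\<^sub>R (Einv o\<^sub>L Q))" "bounded_linear (\<lambda>Q. c *\<^sub>R (Einv o\<^sub>L Q o\<^sub>L B))"
      by (rule bounded_linear_compose[OF bounded_linear_scaleR_right 1],
          rule bounded_linear_compose[OF bounded_linear_scaleR_right 2])
  qed
  have S: "double_summable (S1 t)" "(\<Sum>k. \<Sum>m. S1 t k m) = t powr \<alpha> *\<^sub>R (Einv o\<^sub>L W' (\<alpha> + 1) t o\<^sub>L B)"
    "double_summable (S2 t)" "(\<Sum>k. \<Sum>m. S2 t k m) = t *\<^sub>R (Einv o\<^sub>L W' 2 t)"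
    "double_summable (S3 t)" "(\<Sum>k. \<Sum>m. S3 t k m) = t powr (\<alpha> - 1) *\<^sub>R (Einv o\<^sub>L W' \<alpha> t)"
    if t: "t \<in> {0..T}" for t
  proof -
    have "S1 t = (\<lambda>k m. t powr \<alpha> *\<^sub>R (Einv o\<^sub>L W (\<alpha> + 1) t k m o\<^sub>L B))"
      "S2 t = (\<lambda>k m. t *\<^sub>R (Einv o\<^sub>L W 2 t k m))"
      "S3 t = (\<lambda>k m. t powr (\<alpha> - 1) *\<^sub>R (Einv o\<^sub>L W \<alpha> t k m))"
      using t by (simp_all add: S_eq fun_eq_iff)
    then show "double_summable (S1 t)" "(\<Sum>k. \<Sum>m. S1 t k m) = t powr \<alpha> *\<^sub>R (Einv o\<^sub>L W' (\<alpha> + 1) t o\<^sub>L B)"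
      "double_summable (S2 t)" "(\<Sum>k. \<Sum>m. S2 t k m) = t *\<^sub>R (Einv o\<^sub>L W' 2 t)"
      "double_summable (S3 t)" "(\<Sum>k. \<Sum>m. S3 t k m) = t powr (\<alpha> - 1) *\<^sub>R (Einv o\<^sub>L W' \<alpha> t)"
      using double_series_bounded_linear[OF \<Phi>(2) mls(1)[OF t], of "\<alpha> + 1" "t powr \<alpha>"]
        double_series_bounded_linear[OF \<Phi>(1) mls(1)[OF t], of 2 t]
        double_series_bounded_linear[OF \<Phi>(1) mls(1)[OF t], of \<alpha> "t powr (\<alpha> - 1)"] mls(2)[OF t]
      by simp_all
  qed
  obtain x where x: "C2_on {0..T} x"
    "\<forall>t\<in>{0<..T}. caputo {0..T} \<alpha> x t - A (caputo {0..T} \<beta> x t) = B (x t) + g t"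
    "x 0 = \<eta>" "vector_derivative x (at 0 within {0..T}) = \<eta>'" "\<forall>t\<in>{0..T}. y t = Einv (x t)"
    using \<open>mild_solution T \<alpha> \<beta> Einv A B g \<eta> \<eta>' y\<close> unfolding mild_solution_def by blast
  note volterra = cauchy_problem_volterra[OF T \<alpha> \<beta> g x(1-4)]
  have main: "bochner_integrable (lebesgue_on {0..t}) (F3 t)" "bochner_integrable (lebesgue_on {0..t}) (G3 t)"
    "y t = blinfun_apply (Einv + (t powr \<alpha>) *\<^sub>R (Einv o\<^sub>L W' (\<alpha> + 1) t o\<^sub>L B)) \<eta>
      + t *\<^sub>R blinfun_apply (Einv o\<^sub>L W' 2 t) \<eta>' + bochner_int (lebesgue_on {0..t}) (G3 t)"
    "bochner_int (lebesgue_on {0..t}) (F3 t) = bochner_int (lebesgue_on {0..t}) (G3 t)"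
    if t: "t \<in> {0<..T}" for t
  proof -
    have "continuous_on {0..T} (\<lambda>s. x s - \<eta>)"
      by (intro continuous_intros volterra(1))
    from volterra_solution_formula[OF a \<alpha>(1) T this g volterra(2) t]
    obtain I where I: "has_bochner_int (lebesgue_on {0..t})
        (\<lambda>s. (t - s) powr (\<alpha> - 1) *\<^sub>R W' \<alpha> (t - s) (g s)) I"
      and xt: "x t - \<eta> = t *\<^sub>R W' 2 t \<eta>' + t powr \<alpha> *\<^sub>R W' (\<alpha> + 1) t (B \<eta>) + I"
      unfolding W'_def by blast
    have "has_bochner_int (lebesgue_on {0..t}) (\<lambda>s. Einv ((t - s) powr (\<alpha> - 1) *\<^sub>R W' \<alpha> (t - s) (g s))) (Einv I)"
      by (rule has_bochner_int_bounded_linear[OF I blinfun.bounded_linear_right])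
    then have G: "has_bochner_int (lebesgue_on {0..t}) (G3 t) (Einv I)"
      by (simp add: G3_def blinfun.scaleR_right)
    have "G3 t s = F3 t s" if "s \<in> {0..t}" for s
      using S(6)[of "t - s"] that t by (simp add: G3_def F3_def blinfun.scaleR_left)
    then have F: "has_bochner_int (lebesgue_on {0..t}) (F3 t) (Einv I)"
      by (intro has_bochner_int_cong_AE[OF G] AE_I2) simp
    show "bochner_integrable (lebesgue_on {0..t}) (F3 t)" "bochner_integrable (lebesgue_on {0..t}) (G3 t)"
      "bochner_int (lebesgue_on {0..t}) (F3 t) = bochner_int (lebesgue_on {0..t}) (G3 t)"
      using bochner_int_eqI[OF F] bochner_int_eqI[OF G] by simp_all
    have "y t = Einv (\<eta> + (x t - \<eta>))" using x(5) t by simp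
    also have "\<dots> = blinfun_apply (Einv + (t powr \<alpha>) *\<^sub>R (Einv o\<^sub>L W' (\<alpha> + 1) t o\<^sub>L B)) \<eta>
      + t *\<^sub>R blinfun_apply (Einv o\<^sub>L W' 2 t) \<eta>' + Einv I"
      unfolding xt by (simp add: blinfun.add_right blinfun.add_left blinfun.scaleR_right blinfun.scaleR_left)
    finally show "y t = blinfun_apply (Einv + (t powr \<alpha>) *\<^sub>R (Einv o\<^sub>L W' (\<alpha> + 1) t o\<^sub>L B)) \<eta>
      + t *\<^sub>R blinfun_apply (Einv o\<^sub>L W' 2 t) \<eta>' + bochner_int (lebesgue_on {0..t}) (G3 t)"
      using bochner_int_eqI(2)[OF G] by simp
  qed
  have "(\<forall>t\<in>{0..T}. double_summable (S1 t) \<and> double_summable (S2 t) \<and> double_summable (S3 t) \<and>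
          (\<forall>c\<in>{\<alpha> + 1, 2, \<alpha>}. double_summable (W c t)))"
    using S(1,3,5) mls(1) by blast
  moreover have "\<forall>t\<in>{0<..T}.
          bochner_integrable (lebesgue_on {0..t}) (F3 t) \<and>
          bochner_integrable (lebesgue_on {0..t}) (G3 t) \<and>
          y t = blinfun_apply (Einv + (\<Sum>k. \<Sum>m. S1 t k m)) \<eta>
                + blinfun_apply (\<Sum>k. \<Sum>m. S2 t k m) \<eta>'
                + bochner_int (lebesgue_on {0..t}) (F3 t) \<and>
          y t = blinfun_apply (Einv + (t powr \<alpha>) *\<^sub>R (Einv o\<^sub>L W' (\<alpha> + 1) t o\<^sub>L B)) \<eta>
                + t *\<^sub>R blinfun_apply (Einv o\<^sub>L W' 2 t) \<eta>'
                + bochner_int (lebesgue_on {0..t}) (G3 t)"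
    using main by (auto simp: S(2,4) blinfun.scaleR_left)
  ultimately show ?thesis
    unfolding Let_def
    using bounded_Einv bounded_A bounded_B
    unfolding S1_def S2_def S3_def F3_def G3_def W_def W'_def by blast
qed

end
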